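(* Let $0<a<b<\infty$, $1<p,q<\infty$, $\alpha\in\left(1-\frac1q,1\right)$, and $0<r<\infty$ with $p+q\geq r$. Let $\delta\in[0,1]\cap\left[\frac{r-q}{r},\frac pr\right]$ and $c,d,e\in\mathbb{R}$ be such that $$\frac{\delta}{p}+\frac{1-\delta}{q}=\frac1r,\qquad c=\delta(d-1)+e(1-\delta),\qquad 1+(d-1)p>0.$$ Then there is a constant $C>0$, independent of $u$, such that for every $u\in AC[a,b]$ with $u(a)=0$, $x^{d}\mathfrak{D}^{\alpha}_{a+}u\in L_{\frac{1}{x}}^{p}(a,b)$ and $x^{e}u\in L^{q}(a,b)$, where $\mathfrak{D}^{\alpha}_{a+}$ is the left Hadamard fractional derivative of order $\alpha$, one has $x^{c}u\in L^{r}(a,b)$ and $$\|x^{c}u\|_{L^{r}(a,b)}\leq C\left\|x^{d}\,\mathfrak{D}^{\alpha}_{a+}u\right\|_{L_{\frac{1}{x}}^{p}(a,b)}^{\delta}\|x^{e}u\|^{1-\delta}_{L^{q}(a,b)}.$$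
   Context: $AC[a,b]$ is the space of (real- or complex-valued) absolutely continuous functions on $[a,b]$, $x$ denotes the variable in $(a,b)$, and $\Gamma$ is the Euler gamma function. For $0<\alpha<1$ and $f\in AC[a,b]$ the left Hadamard fractional derivative (of Caputo type) is $\mathfrak{D}_{a+}^{\alpha}f(t)=\frac{1}{\Gamma(1-\alpha)}\int_{a}^{t}\left(\log\frac{t}{s}\right)^{-\alpha}s f'(s)\,\frac{ds}{s}$ (for almost every $t\in(a,b]$). For $p\ge1$, $\|v\|_{L^{p}_{\frac{1}{x}}(a,b)}=\left(\int_{a}^{b}|v(x)|^{p}\frac{dx}{x}\right)^{1/p}$, and $L^p_{\frac1x}(a,b)$ is the corresponding weighted Lebesgue space. Any quantity raised to the power $0$ is $1$. For $r>0$, $\|u\|_{L^r(a,b)}=\left(\int_a^b|u|^r\,dx\right)^{1/r}$. *)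

theory Defs
  imports "HOL-Analysis.Analysis"
begin

text \<open>
  The space AC[a,b]: absolute continuity in the epsilon-eta sense, over all finite
  families of pairwise non-overlapping subintervals.
\<close>

definition AC :: "real \<Rightarrow> real \<Rightarrow> (real \<Rightarrow> 'a::real_normed_vector) set" where
  "AC a b = {f. \<forall>\<epsilon>>0. \<exists>\<eta>>0. \<forall>(n::nat) s t.
      (\<forall>i<n. a \<le> s i \<and> s i \<le> t i \<and> t i \<le> b) \<and>
      disjoint_family_on (\<lambda>i. {s i<..<t i}) {..<n} \<and>
      (\<Sum>i<n. t i - s i) < \<eta>
      \<longrightarrow> (\<Sum>i<n. norm (f (t i) - f (s i))) < \<epsilon>}"

text \<open>
  For 0 < p < 1 the quantity \<open>Lp_norm\<close> below is only a quasi-norm. The Bochner integral of a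
  non-integrable function is 0, so \<open>Lp_norm\<close> is meaningful only for members of \<open>Lp_space\<close>.
\<close>

definition Lp_space :: "'a measure \<Rightarrow> real \<Rightarrow> ('a \<Rightarrow> 'b::real_normed_vector) set" where
  "Lp_space M p = {v \<in> borel_measurable M. integrable M (\<lambda>x. norm (v x) powr p)}"

definition Lp_norm :: "'a measure \<Rightarrow> real \<Rightarrow> ('a \<Rightarrow> 'b::real_normed_vector) \<Rightarrow> real" where
  "Lp_norm M p v = (LINT x|M. norm (v x) powr p) powr (1 / p)"

definition dx_on :: "real \<Rightarrow> real \<Rightarrow> real measure" where
  "dx_on a b = lebesgue_on {a<..<b}"

definition dx_over_x_on :: "real \<Rightarrow> real \<Rightarrow> real measure" where
  "dx_over_x_on a b = density (lebesgue_on {a<..<b}) (\<lambda>x. ennreal (1 / x))"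

text \<open>
  At the null set of points s where f is not differentiable, \<open>vector_derivative\<close> is a junk
  value, and likewise the integral at the null set of points t where it does not converge;
  neither affects Lebesgue integrals.
\<close>

definition hadamard_deriv ::
    "real \<Rightarrow> real \<Rightarrow> (real \<Rightarrow> 'a::euclidean_space) \<Rightarrow> real \<Rightarrow> 'a" where
  "hadamard_deriv a \<alpha> f t =
     (1 / Gamma (1 - \<alpha>)) *\<^sub>R
     (LINT s:{a<..<t}|lebesgue.
        (ln (t / s) powr (- \<alpha>)) *\<^sub>R (s *\<^sub>R vector_derivative f (at s)) /\<^sub>R s)"

text \<open>
  Real power with the convention that the 0-th power of anything is 1
  (whereas \<open>0 powr 0 = 0\<close>).
\<close>

definition rpow :: "real \<Rightarrow> real \<Rightarrow> real" where
  "rpow y s = (if s = 0 then 1 else y powr s)"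

end

(*
  On [a,b] with 0 < a all power weights are bounded above and below, so the weights are harmless.
  Write u as the integral of its almost everywhere derivative g, and D for the Hadamard derivative.
  By Fubini and the Beta integral, the kernel (log (t/s))^(alpha-1) / s inverts the Hadamard
  derivative, so |u| is dominated by the integral of |D| against it.  Its integrals over either
  variable are bounded, so Schur's test gives ||u||_p <= C ||D||_p.
  Hoelder's inequality with exponents p/(delta r) and q/((1-delta) r), applied to
  x^c |u| = (x^(d-1) |u|)^delta (x^e |u|)^(1-delta), yields the claim.

  For the representation of u, the positive variation splits u into monotone absolutely continuous
  functions; these define measures with densities by Radon-Nikodym, and Henstock's lemma with a
  Vitali cover differentiates the indefinite integral of the density almost everywhere.
*)

theory Submission
  imports Defs
begin

section \<open>Variation of absolutely continuous functions\<close>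

text \<open>The obstacle is that \<open>AC\<close> is an epsilon-eta condition, while
  \<open>hadamard_deriv\<close> is built on the pointwise \<open>vector_derivative\<close>. The
  inversion needs both sides at once: the values of \<open>u\<close> as integrals of a density, and
  the same density as the derivative under the Hadamard kernel. Hence the density is constructed
  first, from measures, and only then recognised as the derivative. In the variable
  \<open>ln t\<close> the kernels are those of Abel's equation. The singularity of exponent
  \<open>\<alpha> - 1 > -1\<close> is integrable and the logarithms stay below
  \<open>ln (b / a)\<close>, so the kernel has finite mass in either variable. The condition
  \<open>u a = 0\<close> removes the constant of integration, which a derivative cannot see. The
  estimates run in extended nonnegative integrals: finiteness of the weighted norm of
  \<open>u\<close> is a conclusion of the kernel bound, not an input to it. The constants are built
  from the interval and the exponents alone, hence independent of \<open>u\<close>.\<close>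

definition nonoverlapping :: "real \<Rightarrow> real \<Rightarrow> 'i set \<Rightarrow> ('i \<Rightarrow> real) \<Rightarrow> ('i \<Rightarrow> real) \<Rightarrow> bool" where
  "nonoverlapping a b I s t \<longleftrightarrow> finite I \<and> (\<forall>i\<in>I. a \<le> s i \<and> s i \<le> t i \<and> t i \<le> b) \<and>
     disjoint_family_on (\<lambda>i. {s i<..<t i}) I"

lemma nonoverlapping_reindex:
  assumes "nonoverlapping a b I s t" "bij_betw f J I" "finite J"
  shows "nonoverlapping a b J (\<lambda>j. s (f j)) (\<lambda>j. t (f j))"
  using assms unfolding nonoverlapping_def disjoint_family_on_def bij_betw_def inj_on_def
  by (auto 0 3)

lemma AC_obtain:
  assumes "u \<in> AC a b" "\<epsilon> > 0"
  obtains \<eta> where "\<eta> > 0"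
    "\<And>(I::nat set) s t. nonoverlapping a b I s t \<Longrightarrow> (\<Sum>i\<in>I. t i - s i) < \<eta> \<Longrightarrow>
       (\<Sum>i\<in>I. norm (u (t i) - u (s i))) < \<epsilon>"
proof -
  obtain \<eta> where "\<eta> > 0" and \<eta>: "\<And>(n::nat) s t.
      (\<forall>i<n. a \<le> s i \<and> s i \<le> t i \<and> t i \<le> b) \<and> disjoint_family_on (\<lambda>i. {s i<..<t i}) {..<n} \<and>
      (\<Sum>i<n. t i - s i) < \<eta> \<Longrightarrow> (\<Sum>i<n. norm (u (t i) - u (s i))) < \<epsilon>"
    using assms unfolding AC_def by blast
  show ?thesis
  proof (rule that[OF \<open>\<eta> > 0\<close>])
    fix I :: "nat set" and s t
    assume I: "nonoverlapping a b I s t" "(\<Sum>i\<in>I. t i - s i) < \<eta>"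
    then have "finite I" by (simp add: nonoverlapping_def)
    then obtain f where f: "bij_betw f {..<card I} I"
      using ex_bij_betw_nat_finite[of I] by (auto simp: atLeast0LessThan)
    from nonoverlapping_reindex[OF I(1) f]
    have "nonoverlapping a b {..<card I} (\<lambda>j. s (f j)) (\<lambda>j. t (f j))" by simp
    moreover have "(\<Sum>i<card I. t (f i) - s (f i)) < \<eta>"
      using sum.reindex_bij_betw[OF f, of "\<lambda>i. t i - s i"] I(2) by simp
    ultimately have "(\<Sum>i<card I. norm (u (t (f i)) - u (s (f i)))) < \<epsilon>"
      by (intro \<eta>) (auto simp: nonoverlapping_def)
    then show "(\<Sum>i\<in>I. norm (u (t i) - u (s i))) < \<epsilon>"
      using sum.reindex_bij_betw[OF f, of "\<lambda>i. norm (u (t i) - u (s i))"] by simp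
  qed
qed

text \<open>
  The definition of \<open>AC\<close> speaks of families indexed by natural numbers; other index types are
  needed for concatenated families and for divisions into intervals.
\<close>

lemma AC_transfer:
  assumes "\<And>(I::nat set) s t. nonoverlapping a b I s t \<Longrightarrow> (\<Sum>i\<in>I. t i - s i) < \<eta> \<Longrightarrow>
       (\<Sum>i\<in>I. norm (u (t i) - u (s i))) < \<epsilon>"
    and I: "nonoverlapping a b I s t" "(\<Sum>i\<in>I. t i - s i) < \<eta>"
  shows "(\<Sum>i\<in>I. norm (u (t i) - u (s i))) < \<epsilon>"
proof -
  have "finite I" using I by (simp add: nonoverlapping_def)
  then obtain f where f: "bij_betw f {..<card I} I"
    using ex_bij_betw_nat_finite[of I] by (auto simp: atLeast0LessThan)
  have "(\<Sum>i<card I. norm (u (t (f i)) - u (s (f i)))) < \<epsilon>"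
    by (rule assms(1)[OF nonoverlapping_reindex[OF I(1) f]])
      (use sum.reindex_bij_betw[OF f, of "\<lambda>i. t i - s i"] I(2) in simp_all)
  then show ?thesis
    using sum.reindex_bij_betw[OF f, of "\<lambda>i. norm (u (t i) - u (s i))"] by simp
qed

lemma AC_I:
  assumes "\<And>\<epsilon>. \<epsilon> > 0 \<Longrightarrow> \<exists>\<eta>>0. \<forall>(I::nat set) s t. nonoverlapping a b I s t \<longrightarrow>
      (\<Sum>i\<in>I. t i - s i) < \<eta> \<longrightarrow> (\<Sum>i\<in>I. norm (u (t i) - u (s i))) < \<epsilon>"
  shows "u \<in> AC a b"
  unfolding AC_def
proof (clarify)
  fix \<epsilon> :: real assume "\<epsilon> > 0"
  from assms[OF this] obtain \<eta> where \<eta>: "\<eta> > 0" "\<And>(I::nat set) s t. nonoverlapping a b I s t \<Longrightarrow>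
      (\<Sum>i\<in>I. t i - s i) < \<eta> \<Longrightarrow> (\<Sum>i\<in>I. norm (u (t i) - u (s i))) < \<epsilon>" by blast
  show "\<exists>\<eta>>0. \<forall>(n::nat) s t. (\<forall>i<n. a \<le> s i \<and> s i \<le> t i \<and> t i \<le> b) \<and> disjoint_family_on (\<lambda>i. {s i<..<t i}) {..<n} \<and>
      (\<Sum>i<n. t i - s i) < \<eta> \<longrightarrow> (\<Sum>i<n. norm (u (t i) - u (s i))) < \<epsilon>"
    using \<eta> by (intro exI[of _ \<eta>]) (auto simp: nonoverlapping_def)
qed

lemma AC_diff:
  assumes "u \<in> AC a b" "v \<in> AC a b"
  shows "(\<lambda>x. u x - v x) \<in> AC a b"
proof (rule AC_I)
  fix \<epsilon> :: real assume "\<epsilon> > 0"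
  then have e: "\<epsilon>/2 > 0" by simp
  obtain \<eta> where \<eta>: "\<eta> > 0"
    "\<And>(I::nat set) s t. nonoverlapping a b I s t \<Longrightarrow> (\<Sum>i\<in>I. t i - s i) < \<eta> \<Longrightarrow>
       (\<Sum>i\<in>I. norm (u (t i) - u (s i))) < \<epsilon>/2" by (rule AC_obtain[OF assms(1) e]) (rule that)
  obtain \<theta> where \<theta>: "\<theta> > 0"
    "\<And>(I::nat set) s t. nonoverlapping a b I s t \<Longrightarrow> (\<Sum>i\<in>I. t i - s i) < \<theta> \<Longrightarrow>
       (\<Sum>i\<in>I. norm (v (t i) - v (s i))) < \<epsilon>/2" by (rule AC_obtain[OF assms(2) e]) (rule that)
  show "\<exists>\<eta>>0. \<forall>(I::nat set) s t. nonoverlapping a b I s t \<longrightarrow>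
      (\<Sum>i\<in>I. t i - s i) < \<eta> \<longrightarrow> (\<Sum>i\<in>I. norm (u (t i) - v (t i) - (u (s i) - v (s i)))) < \<epsilon>"
  proof (intro exI[of _ "min \<eta> \<theta>"] conjI allI impI)
    fix I :: "nat set" and s t
    assume I: "nonoverlapping a b I s t" "(\<Sum>i\<in>I. t i - s i) < min \<eta> \<theta>"
    have "norm (u (t i) - v (t i) - (u (s i) - v (s i)))
        \<le> norm (u (t i) - u (s i)) + norm (v (t i) - v (s i))" for i
      using norm_triangle_ineq4[of "u (t i) - u (s i)" "v (t i) - v (s i)"] by (simp add: algebra_simps)
    then have "(\<Sum>i\<in>I. norm (u (t i) - v (t i) - (u (s i) - v (s i))))
        \<le> (\<Sum>i\<in>I. norm (u (t i) - u (s i)) + norm (v (t i) - v (s i)))"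
      by (intro sum_mono)
    also have "\<dots> < \<epsilon>/2 + \<epsilon>/2"
      unfolding sum.distrib using \<eta>(2)[OF I(1)] \<theta>(2)[OF I(1)] I(2) by (intro add_strict_mono) auto
    finally show "(\<Sum>i\<in>I. norm (u (t i) - v (t i) - (u (s i) - v (s i)))) < \<epsilon>" by simp
  qed (use \<eta> \<theta> in auto)
qed

lemma AC_inner:
  fixes u :: "real \<Rightarrow> 'a::euclidean_space"
  assumes "u \<in> AC a b" and "e \<in> Basis"
  shows "(\<lambda>x. u x \<bullet> e) \<in> AC a b"
proof (rule AC_I)
  fix \<epsilon> :: real assume "\<epsilon> > 0"
  obtain \<eta> where \<eta>: "\<eta> > 0"
    "\<And>(I::nat set) s t. nonoverlapping a b I s t \<Longrightarrow> (\<Sum>i\<in>I. t i - s i) < \<eta> \<Longrightarrow>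
       (\<Sum>i\<in>I. norm (u (t i) - u (s i))) < \<epsilon>" by (rule AC_obtain[OF assms(1) \<open>\<epsilon> > 0\<close>]) (rule that)
  have "(\<Sum>i\<in>I. norm (u (t i) \<bullet> e - u (s i) \<bullet> e)) \<le> (\<Sum>i\<in>I. norm (u (t i) - u (s i)))" for I :: "nat set" and s t
    by (intro sum_mono) (metis Basis_le_norm assms(2) inner_diff_left real_norm_def)
  with \<eta> show "\<exists>\<eta>>0. \<forall>(I::nat set) s t. nonoverlapping a b I s t \<longrightarrow>
      (\<Sum>i\<in>I. t i - s i) < \<eta> \<longrightarrow> (\<Sum>i\<in>I. norm (u (t i) \<bullet> e - u (s i) \<bullet> e)) < \<epsilon>"
    by (meson order_le_less_trans)
qed

lemma AC_dist_less:
  assumes "u \<in> AC a b" "\<epsilon> > 0"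
  shows "\<exists>\<eta>>0. \<forall>x y. a \<le> x \<longrightarrow> x \<le> y \<longrightarrow> y \<le> b \<longrightarrow> y - x < \<eta> \<longrightarrow> norm (u y - u x) < \<epsilon>"
proof -
  obtain \<eta> where \<eta>: "\<eta> > 0"
    "\<And>(I::nat set) s t. nonoverlapping a b I s t \<Longrightarrow> (\<Sum>i\<in>I. t i - s i) < \<eta> \<Longrightarrow>
       (\<Sum>i\<in>I. norm (u (t i) - u (s i))) < \<epsilon>" by (rule AC_obtain[OF assms]) (rule that)
  have "norm (u y - u x) < \<epsilon>" if "a \<le> x" "x \<le> y" "y \<le> b" "y - x < \<eta>" for x y
    using \<eta>(2)[of "{0}" "\<lambda>_. x" "\<lambda>_. y"] that by (simp add: nonoverlapping_def disjoint_family_on_def)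
  with \<eta>(1) show ?thesis by blast
qed

text \<open>The open intervals are disjoint, so their lengths add up to the Lebesgue measure of a
  subset of \<open>{a..b}\<close>.\<close>

lemma nonoverlapping_sum_le:
  assumes "nonoverlapping a b I s t" "a \<le> b"
  shows "(\<Sum>i\<in>I. t i - s i) \<le> b - a"
proof -
  have I: "finite I" "\<And>i. i \<in> I \<Longrightarrow> a \<le> s i \<and> s i \<le> t i \<and> t i \<le> b"
    "disjoint_family_on (\<lambda>i. {s i<..<t i}) I"
    using assms unfolding nonoverlapping_def by auto
  have "(\<Sum>i\<in>I. t i - s i) = (\<Sum>i\<in>I. measure lborel {s i<..<t i})"
    using I(2) by (intro sum.cong) auto
  also have "\<dots> = measure lborel (\<Union>i\<in>I. {s i<..<t i})"
    using I by (intro measure_finite_Union[symmetric]) auto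
  also have "\<dots> \<le> measure lborel {a..b}"
  proof (rule measure_mono_fmeasurable)
    show "(\<Union>i\<in>I. {s i<..<t i}) \<subseteq> {a..b}" using I(2) by fastforce
    show "(\<Union>i\<in>I. {s i<..<t i}) \<in> sets lborel" using I(1) by auto
    show "{a..b} \<in> fmeasurable lborel" by (rule fmeasurableI) (auto simp: emeasure_lborel_Icc_eq)
  qed
  finally show ?thesis using assms(2) by simp
qed

text \<open>Each interval is refined by a family inside it. In this way a choice of variation sums
  on several intervals becomes one sum over a single family.\<close>

lemma nonoverlapping_Sigma:
  assumes "nonoverlapping a b I s t"
    and "\<And>i. i \<in> I \<Longrightarrow> nonoverlapping (s i) (t i) (J i) (\<sigma> i) (\<tau> i)"
  shows "nonoverlapping a b (Sigma I J) (\<lambda>(i,j). \<sigma> i j) (\<lambda>(i,j). \<tau> i j)"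
proof -
  have A: "i \<in> I \<Longrightarrow> j \<in> J i \<Longrightarrow> s i \<le> \<sigma> i j \<and> \<sigma> i j \<le> \<tau> i j \<and> \<tau> i j \<le> t i"
    and B: "i \<in> I \<Longrightarrow> a \<le> s i \<and> s i \<le> t i \<and> t i \<le> b" for i j
    using assms unfolding nonoverlapping_def by blast+
  have D: "{\<sigma> i j<..<\<tau> i j} \<inter> {\<sigma> i' j'<..<\<tau> i' j'} = {}"
    if "i \<in> I" "j \<in> J i" "i' \<in> I" "j' \<in> J i'" "(i,j) \<noteq> (i',j')" for i j i' j'
  proof (cases "i = i'")
    case True
    then show ?thesis using that assms(2)[of i]
      unfolding nonoverlapping_def disjoint_family_on_def by blast
  next
    case False
    then have "{s i<..<t i} \<inter> {s i'<..<t i'} = {}"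
      using that assms(1) unfolding nonoverlapping_def disjoint_family_on_def by blast
    moreover have "{\<sigma> i j<..<\<tau> i j} \<subseteq> {s i<..<t i}" "{\<sigma> i' j'<..<\<tau> i' j'} \<subseteq> {s i'<..<t i'}"
      using A that by fastforce+
    ultimately show ?thesis by blast
  qed
  have "finite (Sigma I J)" using assms unfolding nonoverlapping_def by auto
  moreover have "a \<le> \<sigma> i j \<and> \<sigma> i j \<le> \<tau> i j \<and> \<tau> i j \<le> b" if "i \<in> I" "j \<in> J i" for i j
    using A[OF that] B[OF that(1)] by linarith
  moreover have "disjoint_family_on (\<lambda>p. {(case p of (i, j) \<Rightarrow> \<sigma> i j)<..<(case p of (i, j) \<Rightarrow> \<tau> i j)}) (Sigma I J)"
    unfolding disjoint_family_on_def using D by (auto simp: split_paired_all)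
  ultimately show ?thesis
    unfolding nonoverlapping_def by auto
qed

text \<open>The sums whose supremum is the positive variation of \<open>u\<close>.\<close>

definition variation_sums :: "(real \<Rightarrow> real) \<Rightarrow> real \<Rightarrow> real \<Rightarrow> real set" where
  "variation_sums u a b = {\<Sum>i\<in>I. u (t i) - u (s i) | (I::nat set) s t. nonoverlapping a b I s t}"

text \<open>The definition fixes \<open>nat\<close> as index type; an enumeration admits every
  finite index set, in particular the pairs produced by \<open>nonoverlapping_Sigma\<close>.\<close>

lemma variation_sumsI:
  assumes "nonoverlapping a b I s t"
  shows "(\<Sum>i\<in>I. u (t i) - u (s i)) \<in> variation_sums u a b"
proof -
  have "finite I" using assms by (simp add: nonoverlapping_def)
  then obtain f where f: "bij_betw f {..<card I} I"
    using ex_bij_betw_nat_finite[of I] by (auto simp: atLeast0LessThan)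
  have "nonoverlapping a b {..<card I} (\<lambda>j. s (f j)) (\<lambda>j. t (f j))"
    using nonoverlapping_reindex[OF assms f] by simp
  then have "(\<Sum>i<card I. u (t (f i)) - u (s (f i))) \<in> variation_sums u a b"
    unfolding variation_sums_def
    by (intro CollectI exI[of _ "{..<card I}"] exI[of _ "\<lambda>j. s (f j)"] exI[of _ "\<lambda>j. t (f j)"]) simp
  then show ?thesis
    using sum.reindex_bij_betw[OF f, of "\<lambda>i. u (t i) - u (s i)"] by simp
qed

lemma zero_in_variation_sums: "0 \<in> variation_sums u a b"
  using variation_sumsI[of a b "{}::nat set"] by (simp add: nonoverlapping_def disjoint_family_on_def)

lemma variation_sums_mono:
  assumes "b \<le> b'" shows "variation_sums u a b \<subseteq> variation_sums u a b'"
  using assms unfolding variation_sums_def nonoverlapping_def by fastforce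

text \<open>Every interval is cut at \<open>m\<close> by clipping its endpoints with
  \<open>min _ m\<close> and \<open>max _ m\<close>. An interval that does not cross
  \<open>m\<close> becomes degenerate on one side, which \<open>nonoverlapping\<close> permits, and
  contributes 0 there.\<close>

lemma variation_sums_split:
  assumes "x \<in> variation_sums u a b" "a \<le> m" "m \<le> b"
  shows "\<exists>y\<in>variation_sums u a m. \<exists>z\<in>variation_sums u m b. x = y + z"
proof -
  obtain I :: "nat set" and s t where I: "nonoverlapping a b I s t" and x: "x = (\<Sum>i\<in>I. u (t i) - u (s i))"
    using assms unfolding variation_sums_def by blast
  have sub: "{min (s i) m<..<min (t i) m} \<subseteq> {s i<..<t i}" "{max (s i) m<..<max (t i) m} \<subseteq> {s i<..<t i}" for i
    by auto
  have dis: "disjoint_family_on A I" if "\<And>i. A i \<subseteq> {s i<..<t i}" for A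
    using I that unfolding nonoverlapping_def disjoint_family_on_def by blast
  have *: "nonoverlapping a m I (\<lambda>i. min (s i) m) (\<lambda>i. min (t i) m)"
    using I assms(2) dis[OF sub(1)] unfolding nonoverlapping_def by (auto simp: min_le_iff_disj) 
  have **: "nonoverlapping m b I (\<lambda>i. max (s i) m) (\<lambda>i. max (t i) m)"
    using I assms(3) dis[OF sub(2)] unfolding nonoverlapping_def by (auto simp: le_max_iff_disj)
  have "(\<Sum>i\<in>I. u (min (t i) m) - u (min (s i) m)) \<in> variation_sums u a m"
    "(\<Sum>i\<in>I. u (max (t i) m) - u (max (s i) m)) \<in> variation_sums u m b"
    using variation_sumsI[OF *, of u] variation_sumsI[OF **, of u] by simp_all
  moreover have "x = (\<Sum>i\<in>I. u (min (t i) m) - u (min (s i) m)) + (\<Sum>i\<in>I. u (max (t i) m) - u (max (s i) m))"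
    unfolding x sum.distrib[symmetric] by (intro sum.cong) (auto simp: min_def max_def)
  ultimately show ?thesis by blast
qed

text \<open>Total length does not grow under refinement, so smallness passes from \<open>I\<close>
  to \<open>J\<close>. This keeps the \<open>\<eta>\<close> belonging to \<open>u\<close> usable for
  its positive variation.\<close>

lemma variation_sums_Sigma:
  assumes I: "nonoverlapping a b I s t"
    and x: "\<And>i. i \<in> I \<Longrightarrow> x i \<in> variation_sums u (s i) (t i)"
  shows "\<exists>(J::('i \<times> nat) set) \<sigma> \<tau>. nonoverlapping a b J \<sigma> \<tau> \<and>
      (\<Sum>j\<in>J. \<tau> j - \<sigma> j) \<le> (\<Sum>i\<in>(I::'i set). t i - s i) \<and> (\<Sum>i\<in>I. x i) = (\<Sum>j\<in>J. u (\<tau> j) - u (\<sigma> j))"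
proof -
  have "\<forall>i\<in>I. \<exists>(J::nat set) \<sigma> \<tau>. nonoverlapping (s i) (t i) J \<sigma> \<tau> \<and> x i = (\<Sum>j\<in>J. u (\<tau> j) - u (\<sigma> j))"
    using x unfolding variation_sums_def by blast
  then obtain J \<sigma> \<tau> where J: "\<And>i. i \<in> I \<Longrightarrow> nonoverlapping (s i) (t i) (J i :: nat set) (\<sigma> i) (\<tau> i)"
    and xi: "\<And>i. i \<in> I \<Longrightarrow> x i = (\<Sum>j\<in>J i. u (\<tau> i j) - u (\<sigma> i j))"
    by metis
  have fin: "finite I" "\<forall>i\<in>I. finite (J i)" and st: "\<And>i. i \<in> I \<Longrightarrow> s i \<le> t i"
    using I J unfolding nonoverlapping_def by auto
  have "nonoverlapping a b (Sigma I J) (\<lambda>(i,j). \<sigma> i j) (\<lambda>(i,j). \<tau> i j)"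
    by (rule nonoverlapping_Sigma[OF I J])
  moreover have "(\<Sum>(i,j)\<in>Sigma I J. \<tau> i j - \<sigma> i j) \<le> (\<Sum>i\<in>I. t i - s i)"
    unfolding sum.Sigma[OF fin, symmetric] using J st by (intro sum_mono nonoverlapping_sum_le) auto
  moreover have "(\<Sum>i\<in>I. x i) = (\<Sum>(i,j)\<in>Sigma I J. u (\<tau> i j) - u (\<sigma> i j))"
    unfolding sum.Sigma[OF fin, symmetric] using xi by (intro sum.cong) auto
  ultimately show ?thesis
    by (intro exI[of _ "Sigma I J"] exI[of _ "\<lambda>(i,j). \<sigma> i j"] exI[of _ "\<lambda>(i,j). \<tau> i j"])
      (simp add: case_prod_unfold)
qed

text \<open>On an interval shorter than the \<open>\<eta>\<close> belonging to
  \<open>\<epsilon> = 1\<close> every sum is at most 1, and finitely many such intervals exhaust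
  \<open>{a..b}\<close>.\<close>

lemma variation_sums_bounded:
  assumes u: "u \<in> AC a b"
  shows "\<exists>B. \<forall>x\<in>variation_sums u a b. x \<le> B"
proof -
  obtain \<eta> where \<eta>: "\<eta> > 0"
    "\<And>(I::nat set) s t. nonoverlapping a b I s t \<Longrightarrow> (\<Sum>i\<in>I. t i - s i) < \<eta> \<Longrightarrow>
       (\<Sum>i\<in>I. norm (u (t i) - u (s i))) < 1" by (rule AC_obtain[OF u zero_less_one]) (rule that)
  have short: "x \<le> 1" if x: "x \<in> variation_sums u m t" and mt: "a \<le> m" "m \<le> t" "t \<le> b" "t - m < \<eta>" for x m t
  proof -
    obtain I :: "nat set" and \<sigma> \<tau> where I: "nonoverlapping m t I \<sigma> \<tau>" and x: "x = (\<Sum>i\<in>I. u (\<tau> i) - u (\<sigma> i))"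
      using x unfolding variation_sums_def by blast
    have "nonoverlapping a b I \<sigma> \<tau>" using I mt unfolding nonoverlapping_def by fastforce
    moreover have "(\<Sum>i\<in>I. \<tau> i - \<sigma> i) < \<eta>" using nonoverlapping_sum_le[OF I] mt by linarith
    ultimately have "(\<Sum>i\<in>I. norm (u (\<tau> i) - u (\<sigma> i))) < 1" by (rule \<eta>(2))
    moreover have "x \<le> (\<Sum>i\<in>I. norm (u (\<tau> i) - u (\<sigma> i)))"
      unfolding x by (intro sum_mono) auto
    ultimately show ?thesis by simp
  qed
  have grid: "t \<le> a + real k * (\<eta>/2) \<Longrightarrow> a \<le> t \<Longrightarrow> t \<le> b \<Longrightarrow> x \<in> variation_sums u a t \<Longrightarrow> x \<le> real k + 1" for k t x
  proof (induction k arbitrary: t x)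
    case 0
    then show ?case using short[of x a t] \<eta>(1) by auto
  next
    case (Suc k)
    \<comment> \<open>Steps of length \<open>\<eta>/2\<close> keep \<open>t - m\<close> strictly
      below \<open>\<eta>\<close>, as \<open>short\<close> requires; the maximum keeps
      \<open>m\<close> from passing \<open>a\<close>.\<close>
    define m where "m = max a (t - \<eta>/2)"
    have m: "a \<le> m" "m \<le> t" "t - m < \<eta>" using \<eta>(1) Suc.prems by (auto simp: m_def)
    then obtain y z where yz: "y \<in> variation_sums u a m" "z \<in> variation_sums u m t" "x = y + z"
      using variation_sums_split[OF Suc.prems(4)] by blast
    have "y \<le> real k + 1"
    proof (rule Suc.IH)
      show "m \<le> a + real k * (\<eta>/2)" using Suc.prems(1) \<eta>(1) unfolding m_def by (intro max.boundedI) (auto simp: field_simps)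
    qed (use Suc.prems m yz in auto)
    moreover have "z \<le> 1" using short[OF yz(2)] m Suc.prems by auto
    ultimately show ?case using yz by simp
  qed
  show ?thesis
  proof (cases "a \<le> b")
    case True
    obtain k :: nat where "(b - a) / (\<eta>/2) \<le> real k" using real_arch_simple by blast
    then have "b \<le> a + real k * (\<eta>/2)" using \<eta>(1) by (simp add: divide_simps)
    then show ?thesis using grid True by blast
  next
    case False
    have "x = 0" if x: "x \<in> variation_sums u a b" for x
    proof -
      obtain I :: "nat set" and \<sigma> \<tau> where I: "nonoverlapping a b I \<sigma> \<tau>" and x: "x = (\<Sum>i\<in>I. u (\<tau> i) - u (\<sigma> i))"
        using x unfolding variation_sums_def by blast
      have "I = {}" using I False unfolding nonoverlapping_def by fastforce
      then show ?thesis using x by simp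
    qed
    then show ?thesis by auto
  qed
qed

text \<open>The choices in different sets are independent, so one supremum at a time can be taken
  while the other choices stay fixed.\<close>

lemma sum_Sup_le:
  fixes A :: "'i \<Rightarrow> real set"
  assumes "finite I" "\<And>i. i \<in> I \<Longrightarrow> A i \<noteq> {}"
    and "\<And>x. (\<And>i. i \<in> I \<Longrightarrow> x i \<in> A i) \<Longrightarrow> (\<Sum>i\<in>I. x i) \<le> c"
  shows "(\<Sum>i\<in>I. Sup (A i)) \<le> c"
  using assms
proof (induction I arbitrary: c rule: finite_induct)
  case (insert j I)
  have "y \<le> c - (\<Sum>i\<in>I. Sup (A i))" if y: "y \<in> A j" for y
  proof -
    have "(\<Sum>i\<in>I. Sup (A i)) \<le> c - y"
    proof (rule insert.IH)
      fix x assume x: "\<And>i. i \<in> I \<Longrightarrow> x i \<in> A i"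
      have "(\<Sum>i\<in>insert j I. (x(j := y)) i) \<le> c"
        using x y by (intro insert.prems) auto
      moreover have "(\<Sum>i\<in>I. (x(j := y)) i) = (\<Sum>i\<in>I. x i)"
        using insert.hyps by (intro sum.cong) auto
      ultimately show "(\<Sum>i\<in>I. x i) \<le> c - y"
        using insert.hyps by simp
    qed (use insert.prems in auto)
    then show ?thesis by simp
  qed
  then have "Sup (A j) \<le> c - (\<Sum>i\<in>I. Sup (A i))"
    using insert.prems by (intro cSup_least) auto
  then show ?case using insert.hyps by simp
qed simp

text \<open>\<open>P\<close> is the positive variation from \<open>a\<close>. The single interval
  from \<open>s\<close> to \<open>t\<close> already contributes \<open>u t - u s\<close> to its
  growth, so \<open>P - u\<close> increases as well. The increments of \<open>P\<close> over a short
  family are suprema of sums of \<open>u\<close> over refinements, which are no longer than the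
  family, hence small.\<close>

lemma AC_Jordan_decomposition:
  fixes u :: "real \<Rightarrow> real"
  assumes u: "u \<in> AC a b"
  obtains P where "P \<in> AC a b" "mono_on {a..b} P" "mono_on {a..b} (\<lambda>x. P x - u x)"
proof -
  obtain B where B: "\<And>x. x \<in> variation_sums u a b \<Longrightarrow> x \<le> B"
    using variation_sums_bounded[OF u] by blast
  define P where "P = (\<lambda>t. Sup (variation_sums u a t))"
  have bdd: "bdd_above (variation_sums u a t)" if "t \<le> b" for t
    using B variation_sums_mono[OF that] by (meson bdd_aboveI subsetD)
  have le: "P s + x \<le> P t" if st: "a \<le> s" "s \<le> t" "t \<le> b" and x: "x \<in> variation_sums u s t" for s t x
  proof -
    have "y \<le> P t - x" if y: "y \<in> variation_sums u a s" for y
    proof -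
      \<comment> \<open>The family on \<open>[a, s]\<close> and the one on \<open>[s, t]\<close> are
        concatenated by refining this two-element family.\<close>
      have no: "nonoverlapping a t {0::nat, 1} (\<lambda>i. if i = 0 then a else s) (\<lambda>i. if i = 0 then s else t)"
        using st by (auto simp: nonoverlapping_def disjoint_family_on_def)
      have *: "(if i = 0 then y else x) \<in> variation_sums u (if i = 0 then a else s) (if i = 0 then s else t)" for i :: nat
        using x y by simp
      obtain J :: "(nat \<times> nat) set" and \<sigma> \<tau> where J: "nonoverlapping a t J \<sigma> \<tau>"
        "(\<Sum>i\<in>{0::nat, 1}. if i = 0 then y else x) = (\<Sum>j\<in>J. u (\<tau> j) - u (\<sigma> j))"
        using variation_sums_Sigma[OF no, of "\<lambda>i. if i = 0 then y else x" u] * by auto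
      have "y + x \<in> variation_sums u a t"
        using variation_sumsI[OF J(1), of u] J(2) by simp
      then have "y + x \<le> P t" unfolding P_def using bdd st by (intro cSup_upper) auto
      then show ?thesis by simp
    qed
    moreover have "variation_sums u a s \<noteq> {}" using zero_in_variation_sums by blast
    ultimately have "P s \<le> P t - x" unfolding P_def by (intro cSup_least)
    then show ?thesis by simp
  qed
  have ge: "P t - P s \<le> Sup (variation_sums u s t)" if st: "a \<le> s" "s \<le> t" "t \<le> b" for s t
  proof -
    have bdd': "bdd_above (variation_sums u s t)"
      using le[OF st] by (intro bdd_aboveI[of _ "P t - P s"]) (simp add: algebra_simps)
    have "x \<le> P s + Sup (variation_sums u s t)" if x: "x \<in> variation_sums u a t" for x
    proof -
      obtain y z where yz: "y \<in> variation_sums u a s" "z \<in> variation_sums u s t" "x = y + z"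
        using variation_sums_split[OF x] st by blast
      have "y \<le> P s" unfolding P_def using bdd st yz by (intro cSup_upper) auto
      moreover have "z \<le> Sup (variation_sums u s t)" using bdd' yz by (intro cSup_upper) auto
      ultimately show ?thesis using yz by simp
    qed
    moreover have "variation_sums u a t \<noteq> {}" using zero_in_variation_sums by blast
    ultimately have "P t \<le> P s + Sup (variation_sums u s t)" unfolding P_def by (intro cSup_least)
    then show ?thesis by simp
  qed
  have single: "u t - u s \<in> variation_sums u s t" if "s \<le> t" for s t
    using variation_sumsI[of s t "{0::nat}" "\<lambda>_. s" "\<lambda>_. t" u] that
    by (simp add: nonoverlapping_def disjoint_family_on_def)
  have mono: "mono_on {a..b} P"
    using le[OF _ _ _ zero_in_variation_sums] by (auto intro!: mono_onI)
  have mono': "mono_on {a..b} (\<lambda>x. P x - u x)"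
    using le[OF _ _ _ single] by (auto intro!: mono_onI) (smt (verit))
  have "P \<in> AC a b"
  proof (rule AC_I)
    fix \<epsilon> :: real assume "\<epsilon> > 0"
    \<comment> \<open>Half of \<open>\<epsilon>\<close>, because passing to suprema turns the strict
      bound for \<open>u\<close> into a weak one.\<close>
    then have e: "\<epsilon>/2 > 0" by simp
    obtain \<eta> where \<eta>: "\<eta> > 0"
      "\<And>(I::nat set) s t. nonoverlapping a b I s t \<Longrightarrow> (\<Sum>i\<in>I. t i - s i) < \<eta> \<Longrightarrow>
       (\<Sum>i\<in>I. norm (u (t i) - u (s i))) < \<epsilon>/2" by (rule AC_obtain[OF u e]) (rule that)
    show "\<exists>\<eta>>0. \<forall>(I::nat set) s t. nonoverlapping a b I s t \<longrightarrow>
      (\<Sum>i\<in>I. t i - s i) < \<eta> \<longrightarrow> (\<Sum>i\<in>I. norm (P (t i) - P (s i))) < \<epsilon>"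
    proof (intro exI[of _ \<eta>] conjI allI impI \<eta>(1))
      fix I :: "nat set" and s t
      assume I: "nonoverlapping a b I s t" "(\<Sum>i\<in>I. t i - s i) < \<eta>"
      have i: "a \<le> s i \<and> s i \<le> t i \<and> t i \<le> b" if "i \<in> I" for i
        using I that unfolding nonoverlapping_def by blast
      have "(\<Sum>i\<in>I. norm (P (t i) - P (s i))) \<le> (\<Sum>i\<in>I. Sup (variation_sums u (s i) (t i)))"
      proof (rule sum_mono)
        fix k assume k: "k \<in> I"
        then have "P (s k) \<le> P (t k)" using mono i by (intro mono_onD[OF mono]) force+
        then show "norm (P (t k) - P (s k)) \<le> Sup (variation_sums u (s k) (t k))"
          using ge[of "s k" "t k"] i[OF k] by simp
      qed
      also have "\<dots> \<le> \<epsilon>/2"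
      proof (rule sum_Sup_le)
        show "finite I" using I unfolding nonoverlapping_def by blast
        show "variation_sums u (s i) (t i) \<noteq> {}" for i using zero_in_variation_sums by blast
        fix x assume x: "\<And>i. i \<in> I \<Longrightarrow> x i \<in> variation_sums u (s i) (t i)"
        obtain J :: "(nat \<times> nat) set" and \<sigma> \<tau> where J: "nonoverlapping a b J \<sigma> \<tau>"
          "(\<Sum>j\<in>J. \<tau> j - \<sigma> j) \<le> (\<Sum>i\<in>I. t i - s i)" "(\<Sum>i\<in>I. x i) = (\<Sum>j\<in>J. u (\<tau> j) - u (\<sigma> j))"
          using variation_sums_Sigma[OF I(1) x] by blast
        have "(\<Sum>j\<in>J. norm (u (\<tau> j) - u (\<sigma> j))) < \<epsilon>/2"
          by (rule AC_transfer[OF \<eta>(2) J(1)]) (use J(2) I(2) in auto)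
        moreover have "(\<Sum>i\<in>I. x i) \<le> (\<Sum>j\<in>J. norm (u (\<tau> j) - u (\<sigma> j)))"
          unfolding J(3) by (intro sum_mono) auto
        ultimately show "(\<Sum>i\<in>I. x i) \<le> \<epsilon>/2" by simp
      qed
      also have "\<dots> < \<epsilon>" using \<open>\<epsilon> > 0\<close> by simp
      finally show "(\<Sum>i\<in>I. norm (P (t i) - P (s i))) < \<epsilon>" .
    qed
  qed
  with mono mono' that show thesis by blast
qed

section \<open>Densities of absolutely continuous functions\<close>

text \<open>\<open>G\<close> extends \<open>F\<close> by constants, since
  \<open>interval_measure\<close> takes a function on the whole line. A null set lies in an open set
  of length below \<open>\<eta>\<close>; a finite union of boxes inside it has as measure at most a
  sum of increments of \<open>F\<close> over a short non-overlapping family, hence at most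
  \<open>\<epsilon>\<close>. Continuity from below carries this bound to the open set.\<close>

lemma interval_measure_absolutely_continuous:
  assumes F: "F \<in> AC a b" "mono_on {a..b} F" and ab: "a \<le> b"
    and G: "G = (\<lambda>x. F (max a (min b x)))"
  shows "mono G" "continuous_on UNIV G" "absolutely_continuous lborel (interval_measure G)"
proof -
  \<comment> \<open>Clamping to \<open>[a, b]\<close> is monotone and does not increase distances,
    so families on the line become families in \<open>[a, b]\<close> that are no longer and still
    non-overlapping.\<close>
  define \<kappa> where "\<kappa> x = max a (min b x)" for x
  have \<kappa>: "a \<le> \<kappa> x" "\<kappa> x \<le> b" for x using ab by (auto simp: \<kappa>_def)
  have \<kappa>_mono: "\<kappa> x \<le> \<kappa> y" if "x \<le> y" for x y using that by (auto simp: \<kappa>_def)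
  have \<kappa>_dist: "\<kappa> y - \<kappa> x \<le> y - x" if "x \<le> y" for x y using that ab by (auto simp: \<kappa>_def min_def max_def)
  have G\<kappa>: "G = (\<lambda>x. F (\<kappa> x))" by (simp add: G \<kappa>_def)
  show mono: "mono G"
    using F(2) \<kappa> \<kappa>_mono unfolding G\<kappa> by (auto intro!: monoI mono_onD[OF F(2)])
  show cont: "continuous_on UNIV G"
    unfolding continuous_on_iff
  proof (intro ballI allI impI)
    fix x e :: real assume "e > 0"
    obtain \<eta> where \<eta>: "\<eta> > 0" "\<And>x y. a \<le> x \<Longrightarrow> x \<le> y \<Longrightarrow> y \<le> b \<Longrightarrow> y - x < \<eta> \<Longrightarrow> norm (F y - F x) < e"
      using AC_dist_less[OF F(1) \<open>e > 0\<close>] by blast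
    have "dist (G y) (G x) < e" if "dist y x < \<eta>" for y
    proof (cases "x \<le> y")
      case True
      then show ?thesis using \<eta>(2)[of "\<kappa> x" "\<kappa> y"] \<kappa> \<kappa>_mono[OF True] \<kappa>_dist[OF True] that
        by (simp add: G\<kappa> dist_real_def)
    next
      case False
      then have yx: "y \<le> x" by simp
      then show ?thesis using \<eta>(2)[of "\<kappa> y" "\<kappa> x"] \<kappa> \<kappa>_mono[OF yx] \<kappa>_dist[OF yx] that
        by (simp add: G\<kappa> dist_real_def abs_minus_commute)
    qed
    then show "\<exists>d>0. \<forall>x'\<in>UNIV. dist x' x < d \<longrightarrow> dist (G x') (G x) < e" using \<eta>(1) by blast
  qed
  let ?M = "interval_measure G"
  have Icc: "emeasure ?M {s..t} = ennreal (G t - G s)" if "s \<le> t" for s t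
    by (rule emeasure_interval_measure_Icc[OF that]) (use mono cont in \<open>auto simp: mono_def\<close>)
  show "absolutely_continuous lborel ?M"
    unfolding absolutely_continuous_def
  proof
    fix N :: "real set" assume N: "N \<in> null_sets lborel"
    have "emeasure ?M N \<le> 0 + ennreal \<epsilon>" if \<epsilon>: "\<epsilon> > 0" for \<epsilon>
    proof -
      obtain \<eta> where \<eta>: "\<eta> > 0"
        "\<And>(I::nat set) s t. nonoverlapping a b I s t \<Longrightarrow> (\<Sum>i\<in>I. t i - s i) < \<eta> \<Longrightarrow>
           (\<Sum>i\<in>I. norm (F (t i) - F (s i))) < \<epsilon>" by (rule AC_obtain[OF F(1) \<epsilon>]) (rule that)
      have "N \<in> sets lebesgue" using N by (simp add: null_sets_def)
      then obtain T where T: "open T" "N \<subseteq> T" "emeasure lebesgue (T - N) < ennreal \<eta>"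
        using sets_lebesgue_outer_open[of N \<eta>] \<eta>(1) by metis
      have NT: "N \<in> sets lborel" "T \<in> sets lborel" using N T(1) by (auto simp: null_sets_def)
      have "emeasure lborel T = emeasure lborel (N \<union> (T - N))" using T(2) by (simp add: Un_absorb1)
      also have "\<dots> \<le> emeasure lborel N + emeasure lborel (T - N)"
        using NT by (intro emeasure_subadditive) auto
      also have "emeasure lborel N = 0" using N by (simp add: null_sets_def)
      also have "emeasure lborel (T - N) = emeasure lebesgue (T - N)"
        using NT by simp
      finally have T\<eta>: "emeasure lborel T < ennreal \<eta>" using T(3) by simp
      obtain \<D> where \<D>: "countable \<D>" "\<D> \<subseteq> Pow T" "\<And>X. X \<in> \<D> \<Longrightarrow> \<exists>a b. X = cbox a b" "\<Union>\<D> = T"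
        using open_countable_Union_open_cbox[OF T(1)] by metis
      have fin: "emeasure ?M (\<Union>\<F>) \<le> ennreal \<epsilon>" if \<F>: "finite \<F>" "\<F> \<subseteq> \<D>" for \<F>
      proof -
        \<comment> \<open>The boxes in \<open>\<F>\<close> may overlap; the intervals of a division
          of their union do not. The division, a set of sets, is its own index set, whence the later
          use of \<open>AC_transfer\<close>.\<close>
        obtain p where p: "p division_of (\<Union>\<F>)"
          using elementary_unions_intervals[of \<F>] \<F> \<D>(3) by blast
        have fp: "finite p" using p by blast
        have K: "K = {Inf K..Sup K} \<and> Inf K \<le> Sup K \<and> K \<subseteq> T" if "K \<in> p" for K
        proof -
          obtain u v where uv: "K = cbox u v" "K \<noteq> {}" "K \<subseteq> \<Union>\<F>" using division_ofD[OF p] \<open>K \<in> p\<close> by metis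
          then show ?thesis using \<F> \<D>(4) by auto
        qed
        have disj: "disjoint_family_on (\<lambda>K. {Inf K<..<Sup K}) p"
          unfolding disjoint_family_on_def
        proof (intro ballI impI)
          fix K L assume KL: "K \<in> p" "L \<in> p" "K \<noteq> L"
          then have "interior K \<inter> interior L = {}" using division_ofD(5)[OF p] by blast
          moreover have "interior K = {Inf K<..<Sup K}" "interior L = {Inf L<..<Sup L}"
            using K KL by (metis interior_atLeastAtMost_real)+
          ultimately show "{Inf K<..<Sup K} \<inter> {Inf L<..<Sup L} = {}" by simp
        qed
        have Tfin: "T \<in> fmeasurable lborel" using T\<eta> T(1) by (intro fmeasurableI) (auto simp: less_top[symmetric] top.extremum_strict intro: order.strict_trans)
        have "(\<Sum>K\<in>p. Sup K - Inf K) = (\<Sum>K\<in>p. measure lborel {Inf K<..<Sup K})"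
          using K by (intro sum.cong) auto
        also have "\<dots> = measure lborel (\<Union>K\<in>p. {Inf K<..<Sup K})"
          using fp disj K by (intro measure_finite_Union[symmetric]) auto
        also have "\<dots> \<le> measure lborel T"
        proof (rule measure_mono_fmeasurable[OF _ _ Tfin])
          have "{Inf K<..<Sup K} \<subseteq> T" if "K \<in> p" for K
            using K[OF that] by (metis greaterThanLessThan_subseteq_atLeastAtMost_iff order_refl subset_trans)
          then show "(\<Union>K\<in>p. {Inf K<..<Sup K}) \<subseteq> T" by blast
        qed (use fp in auto)
        also have "\<dots> < \<eta>" using T\<eta> Tfin
          by (simp add: emeasure_eq_measure2 ennreal_less_iff)
        finally have len: "(\<Sum>K\<in>p. Sup K - Inf K) < \<eta>" .
        have no: "nonoverlapping a b p (\<lambda>K. \<kappa> (Inf K)) (\<lambda>K. \<kappa> (Sup K))"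
          unfolding nonoverlapping_def
        proof (intro conjI ballI fp)
          fix K assume "K \<in> p"
          then show "a \<le> \<kappa> (Inf K)" "\<kappa> (Inf K) \<le> \<kappa> (Sup K)" "\<kappa> (Sup K) \<le> b"
            using K[of K] \<kappa> \<kappa>_mono by auto
        next
          have "{\<kappa> x<..<\<kappa> y} \<subseteq> {x<..<y}" for x y using ab by (auto simp: \<kappa>_def min_def max_def split: if_splits)
          then show "disjoint_family_on (\<lambda>K. {\<kappa> (Inf K)<..<\<kappa> (Sup K)}) p"
            using disj unfolding disjoint_family_on_def by blast
        qed
        have "(\<Sum>K\<in>p. \<kappa> (Sup K) - \<kappa> (Inf K)) \<le> (\<Sum>K\<in>p. Sup K - Inf K)"
          using K \<kappa>_dist by (intro sum_mono) auto
        with len have "(\<Sum>K\<in>p. \<kappa> (Sup K) - \<kappa> (Inf K)) < \<eta>" by simp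
        from AC_transfer[OF \<eta>(2) no this]
        have small: "(\<Sum>K\<in>p. norm (G (Sup K) - G (Inf K))) < \<epsilon>" by (simp add: G\<kappa>)
        have "emeasure ?M (\<Union>\<F>) = emeasure ?M (\<Union>K\<in>p. K)" using division_ofD(6)[OF p] by simp
        also have "\<dots> \<le> (\<Sum>K\<in>p. emeasure ?M K)"
          using fp K by (intro emeasure_subadditive_finite) (auto, metis atLeastAtMost_borel)
        also have "\<dots> = (\<Sum>K\<in>p. ennreal (G (Sup K) - G (Inf K)))"
          using K Icc by (intro sum.cong) (auto, metis)
        also have "\<dots> = ennreal (\<Sum>K\<in>p. G (Sup K) - G (Inf K))"
          using K mono by (intro sum_ennreal) (auto simp: mono_def)
        also have "\<dots> \<le> ennreal \<epsilon>"
        proof (rule ennreal_leI)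
          have "(\<Sum>K\<in>p. G (Sup K) - G (Inf K)) \<le> (\<Sum>K\<in>p. norm (G (Sup K) - G (Inf K)))"
            by (intro sum_mono) auto
          with small show "(\<Sum>K\<in>p. G (Sup K) - G (Inf K)) \<le> \<epsilon>" by simp
        qed
        finally show ?thesis .
      qed
      show ?thesis
      proof (cases "\<D> = {}")
        case True
        then show ?thesis using \<D>(4) T(2) by auto
      next
        case False
        define A where "A n = \<Union> (from_nat_into \<D> ` {..<n})" for n
        have D: "from_nat_into \<D> n \<in> \<D>" for n using False by (rule from_nat_into)
        have "(\<Union>n. A n) = (\<Union>n. from_nat_into \<D> n)"
          unfolding A_def by blast
        also have "\<dots> = \<Union>\<D>" using range_from_nat_into[OF False \<D>(1)] by simp
        finally have UA: "(\<Union>n. A n) = \<Union>\<D>" .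
        have "A n \<in> sets ?M" for n
        proof -
          have "from_nat_into \<D> i \<in> sets borel" for i using \<D>(3)[OF D[of i]] by auto
          then show ?thesis unfolding A_def by (auto intro!: sets.finite_UN)
        qed
        moreover have "incseq A" unfolding A_def incseq_def by (intro allI impI Union_mono image_mono) auto
        ultimately have "(SUP n. emeasure ?M (A n)) = emeasure ?M (\<Union>\<D>)"
          using SUP_emeasure_incseq[of A ?M] UA by (simp add: image_subset_iff)
        moreover have "emeasure ?M (A n) \<le> ennreal \<epsilon>" for n
          unfolding A_def using D by (intro fin) auto
        ultimately have "emeasure ?M T \<le> ennreal \<epsilon>" using \<D>(4) by (metis SUP_least)
        moreover have "emeasure ?M N \<le> emeasure ?M T" using T by (intro emeasure_mono) auto
        ultimately show ?thesis by simp
      qed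
    qed
    then have "emeasure ?M N \<le> 0" by (rule ennreal_le_epsilon)
    then show "N \<in> null_sets ?M" using N by (auto simp: null_sets_def)
  qed
qed

text \<open>The density of the measure of \<open>G\<close>. By continuity of \<open>G\<close> the
  point \<open>a\<close> carries no mass, so the closed interval \<open>{a..t}\<close> has measure
  exactly \<open>F t - F a\<close>.\<close>

lemma AC_mono_density:
  assumes F: "F \<in> AC a b" "mono_on {a..b} F" and ab: "a \<le> b"
  obtains g :: "real \<Rightarrow> real" where "integrable lborel g"
    "\<And>t. t \<in> {a..b} \<Longrightarrow> F t - F a = (LINT x:{a..t}|lborel. g x)"
proof -
  define G where "G = (\<lambda>x. F (max a (min b x)))"
  note G = interval_measure_absolutely_continuous[OF F ab G_def]
  let ?M = "interval_measure G"
  have Icc: "emeasure ?M {s..t} = ennreal (G t - G s)" if "s \<le> t" for s t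
    by (rule emeasure_interval_measure_Icc[OF that]) (use G in \<open>auto simp: mono_def\<close>)
  obtain f where f[measurable]: "f \<in> borel_measurable lborel" and fM: "density lborel f = ?M"
    using sigma_finite_measure.Radon_Nikodym[OF lborel.sigma_finite_measure_axioms G(3)] by auto
  have fint: "(\<integral>\<^sup>+x. f x * indicator {a..t} x \<partial>lborel) = ennreal (F t - F a)" if t: "t \<in> {a..b}" for t
  proof -
    have "(\<integral>\<^sup>+x. f x * indicator {a..t} x \<partial>lborel) = emeasure ?M {a..t}"
      unfolding fM[symmetric] by (subst emeasure_density) auto
    also have "\<dots> = ennreal (F t - F a)" using t Icc[of a t] by (simp add: G_def)
    finally show ?thesis .
  qed
  \<comment> \<open>The Radon-Nikodym density may be infinite on a null set; \<open>enn2real\<close>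
    sends that value to 0, which changes no integral.\<close>
  define g where "g x = enn2real (f x) * indicator {a..b} x" for x
  have g[measurable]: "g \<in> borel_measurable lborel" unfolding g_def by measurable
  have "AE x in lborel. f x * indicator {a..b} x \<noteq> \<infinity>"
    using fint[of b] ab by (intro nn_integral_PInf_AE) auto
  then have ae: "AE x in lborel. ennreal (g x) = f x * indicator {a..b} x"
    by eventually_elim (auto simp: g_def less_top indicator_def)
  have gt: "(\<integral>\<^sup>+x. ennreal (g x * indicator {a..t} x) \<partial>lborel) = ennreal (F t - F a)" if t: "t \<in> {a..b}" for t
  proof -
    have "(\<integral>\<^sup>+x. ennreal (g x * indicator {a..t} x) \<partial>lborel) = (\<integral>\<^sup>+x. f x * indicator {a..t} x \<partial>lborel)"
      by (rule nn_integral_cong_AE, use ae in eventually_elim) (use t in \<open>auto simp: indicator_def\<close>)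
    then show ?thesis using fint[OF t] by simp
  qed
  have g0: "g x \<ge> 0" for x by (simp add: g_def)
  show thesis
  proof (rule that)
    have "(\<integral>\<^sup>+x. ennreal (g x) \<partial>lborel) = (\<integral>\<^sup>+x. ennreal (g x * indicator {a..b} x) \<partial>lborel)"
      by (intro nn_integral_cong) (auto simp: g_def indicator_def)
    then show "integrable lborel g"
      using gt[of b] ab g0 by (intro integrableI_nonneg) auto
    fix t assume t: "t \<in> {a..b}"
    have "0 \<le> F t - F a" using mono_onD[OF F(2), of a t] t by simp
    then show "F t - F a = (LINT x:{a..t}|lborel. g x)"
      unfolding set_lebesgue_integral_def
      using gt[OF t] g0 by (subst integral_eq_nn_integral) (auto simp: mult.commute)
  qed
qed

text \<open>Each coordinate is the difference of the monotone functions \<open>P\<close> and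
  \<open>P - u \<bullet> e\<close>, and its density is the difference of theirs.\<close>

lemma AC_density:
  fixes u :: "real \<Rightarrow> 'a::euclidean_space"
  assumes u: "u \<in> AC a b" and ab: "a \<le> b"
  obtains g where "integrable lborel g"
    "\<And>t. t \<in> {a..b} \<Longrightarrow> u t - u a = (LINT x:{a..t}|lborel. g x)"
proof -
  have "\<exists>g::real \<Rightarrow> real. integrable lborel g \<and> (\<forall>t\<in>{a..b}. u t \<bullet> e - u a \<bullet> e = (LINT x:{a..t}|lborel. g x))"
    if e: "e \<in> Basis" for e
  proof -
    obtain P where P: "P \<in> AC a b" "mono_on {a..b} P" "mono_on {a..b} (\<lambda>x. P x - u x \<bullet> e)"
      using AC_Jordan_decomposition[OF AC_inner[OF u e]] by blast
    obtain g where g: "integrable lborel g" "\<And>t. t \<in> {a..b} \<Longrightarrow> P t - P a = (LINT x:{a..t}|lborel. g x)"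
      by (rule AC_mono_density[OF P(1,2) ab]) (rule that)
    obtain h where h: "integrable lborel h" "\<And>t. t \<in> {a..b} \<Longrightarrow>
        (P t - u t \<bullet> e) - (P a - u a \<bullet> e) = (LINT x:{a..t}|lborel. h x)"
      by (rule AC_mono_density[OF AC_diff[OF P(1) AC_inner[OF u e]] P(3) ab]) (rule that)
    show ?thesis
    proof (intro exI[of _ "\<lambda>x. g x - h x"] conjI ballI)
      fix t assume t: "t \<in> {a..b}"
      have "set_integrable lborel {a..t} g" "set_integrable lborel {a..t} h"
        unfolding set_integrable_def using g(1) h(1) by (auto intro!: integrable_mult_indicator simp del: real_scaleR_def)
      then have "(LINT x:{a..t}|lborel. g x - h x) = (P t - P a) - ((P t - u t \<bullet> e) - (P a - u a \<bullet> e))"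
        unfolding g(2)[OF t] h(2)[OF t] by (rule set_integral_diff)
      then show "u t \<bullet> e - u a \<bullet> e = (LINT x:{a..t}|lborel. g x - h x)" by simp
    qed (use g h in auto)
  qed
  then obtain g :: "'a \<Rightarrow> real \<Rightarrow> real" where g: "\<And>e. e \<in> Basis \<Longrightarrow> integrable lborel (g e)"
    "\<And>e t. e \<in> Basis \<Longrightarrow> t \<in> {a..b} \<Longrightarrow> u t \<bullet> e - u a \<bullet> e = (LINT x:{a..t}|lborel. g e x)"
    by metis
  show thesis
  proof (rule that[of "\<lambda>x. \<Sum>e\<in>Basis. g e x *\<^sub>R e"])
    show int: "integrable lborel (\<lambda>x. \<Sum>e\<in>Basis. g e x *\<^sub>R e)"
      using g(1) by (intro Bochner_Integration.integrable_sum integrable_scaleR_left) auto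
    fix t assume t: "t \<in> {a..b}"
    have si: "set_integrable lborel {a..t} (g e)" if "e \<in> Basis" for e
      unfolding set_integrable_def using g(1)[OF that] by (intro integrable_mult_indicator) auto
    have "(LINT x:{a..t}|lborel. (\<Sum>e\<in>Basis. g e x *\<^sub>R e))
        = (LINT x|lborel. (\<Sum>e\<in>Basis. (indicator {a..t} x *\<^sub>R g e x) *\<^sub>R e))"
      unfolding set_lebesgue_integral_def by (simp add: scaleR_sum_right)
    also have "\<dots> = (\<Sum>e\<in>Basis. (LINT x:{a..t}|lborel. g e x) *\<^sub>R e)"
      unfolding set_lebesgue_integral_def
      using si unfolding set_integrable_def
      by (subst Bochner_Integration.integral_sum) (auto intro!: sum.cong integrable_scaleR_left)
    also have "\<dots> = (\<Sum>e\<in>Basis. ((u t - u a) \<bullet> e) *\<^sub>R e)"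
      using g(2)[OF _ t] by (intro sum.cong) (auto simp: inner_diff_left)
    also have "\<dots> = u t - u a" by (rule euclidean_representation)
    finally show "u t - u a = (LINT x:{a..t}|lborel. (\<Sum>e\<in>Basis. g e x *\<^sub>R e))" by simp
  qed
qed

section \<open>Differentiation of the indefinite integral\<close>

text \<open>
  Where differentiability fails, arbitrarily short intervals carry an error in Henstock's lemma
  comparable to their length; a Vitali cover by such intervals has small total length.
\<close>

lemma has_vector_derivative_indefinite_integral_AE:
  fixes f :: "real \<Rightarrow> 'b::euclidean_space"
  assumes f: "f integrable_on {a..b}"
  shows "negligible {x \<in> {a<..<b}. \<not> ((\<lambda>t. integral {a..t} f) has_vector_derivative f x) (at x)}"
proof -
  define F where "F = (\<lambda>t. integral {a..t} f)"
  \<comment> \<open>The points near which difference quotients miss \<open>f x\<close> by more than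
    \<open>1 / Suc k\<close> at arbitrarily small distance; the exceptional set is contained in the
    union over \<open>k\<close>.\<close>
  define E where "E k = {x \<in> {a<..<b}. \<forall>d>0. \<exists>y. y \<in> {a<..<b} \<and> y \<noteq> x \<and> \<bar>y - x\<bar> < d \<and>
      norm (F y - F x - (y - x) *\<^sub>R f x) > \<bar>y - x\<bar> / real (Suc k)}" for k
  have neg: "negligible (E k)" for k
    unfolding negligible_outer_le
  proof (intro allI impI)
    fix e :: real assume e: "e > 0"
    \<comment> \<open>The factor 5 pays for the enlargement of balls in Vitali's lemma, the factor
      \<open>Suc k\<close> for turning Henstock's error into length.\<close>
    define e' where "e' = e / (5 * real (Suc k))"
    have e': "e' > 0" using e by (simp add: e'_def)
    obtain \<gamma> where \<gamma>: "gauge \<gamma>"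
      and H: "\<And>p. \<lbrakk>p tagged_partial_division_of (cbox a b); \<gamma> fine p\<rbrakk> \<Longrightarrow>
             (\<Sum>(x,k)\<in>p. norm (measure lborel k *\<^sub>R f x - integral k f)) < e'"
      using Henstock_lemma[of f a b e'] f e' by auto
    \<comment> \<open>The interval between \<open>x\<close> and \<open>y\<close> is written as a
      ball around its midpoint, the shape that Vitali's lemma handles.\<close>
    have "\<exists>y. y \<in> {a<..<b} \<and> y \<noteq> x \<and> cball ((x + y) / 2) (\<bar>y - x\<bar> / 2) \<subseteq> \<gamma> x \<and>
      norm (F y - F x - (y - x) *\<^sub>R f x) > \<bar>y - x\<bar> / real (Suc k)" if x: "x \<in> E k" for x
    proof -
      have "x \<in> \<gamma> x" "open (\<gamma> x)" using \<gamma> by (auto simp: gauge_def)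
      then obtain d where d: "d > 0" "ball x d \<subseteq> \<gamma> x" by (meson openE)
      then obtain y where y: "y \<in> {a<..<b}" "y \<noteq> x" "\<bar>y - x\<bar> < d"
        "norm (F y - F x - (y - x) *\<^sub>R f x) > \<bar>y - x\<bar> / real (Suc k)"
        using x unfolding E_def by blast
      have "cball ((x + y) / 2) (\<bar>y - x\<bar> / 2) \<subseteq> ball x d"
        using y(3) by (auto simp: dist_real_def abs_if field_simps split: if_splits)
      then show ?thesis using y d by blast
    qed
    then obtain y where y: "\<And>x. x \<in> E k \<Longrightarrow> y x \<in> {a<..<b}" "\<And>x. x \<in> E k \<Longrightarrow> y x \<noteq> x"
      "\<And>x. x \<in> E k \<Longrightarrow> cball ((x + y x) / 2) (\<bar>y x - x\<bar> / 2) \<subseteq> \<gamma> x"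
      "\<And>x. x \<in> E k \<Longrightarrow> norm (F (y x) - F x - (y x - x) *\<^sub>R f x) > \<bar>y x - x\<bar> / real (Suc k)"
      by metis
    define c r where "c x = (x + y x) / 2" and "r x = \<bar>y x - x\<bar> / 2" for x
    have xE: "x \<in> {a<..<b}" if "x \<in> E k" for x using that by (auto simp: E_def)
    have xJ: "x \<in> cball (c x) (r x)" for x
      by (auto simp: c_def r_def dist_real_def abs_if field_simps)
    have r: "0 < r x \<and> r x \<le> b - a" if "x \<in> E k" for x
      using y(1,2)[OF that] xE[OF that] by (auto simp: r_def)
    have J: "cball (c x) (r x) = {min x (y x)..max x (y x)}" for x
      by (simp add: cball_eq_atLeastAtMost c_def r_def min_def max_def abs_if field_simps)
    \<comment> \<open>By the choice of \<open>y x\<close>, the length of each interval is controlled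
      by the term that it contributes to Henstock's sum.\<close>
    have err: "2 * r x \<le> real (Suc k) * norm (measure lborel (cball (c x) (r x)) *\<^sub>R f x - integral (cball (c x) (r x)) f)"
      if x: "x \<in> E k" for x
    proof -
      have int: "f integrable_on {u..v}" if "a \<le> u" "v \<le> b" for u v
        using integrable_subinterval_real[OF f] that by auto
      have comb: "F v - F u = integral {u..v} f" if "a \<le> u" "u \<le> v" "v \<le> b" for u v
        using Henstock_Kurzweil_Integration.integral_combine[of a u v f] int that unfolding F_def
        by (simp add: algebra_simps) 
      have "norm (F (y x) - F x - (y x - x) *\<^sub>R f x) = norm (measure lborel (cball (c x) (r x)) *\<^sub>R f x - integral (cball (c x) (r x)) f)"
      proof (cases "x \<le> y x")
        case True
        then show ?thesis using comb[of x "y x"] xE[OF x] y(1)[OF x] unfolding J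
          by (simp add: min_def max_def norm_minus_commute)
      next
        case False
        then have "F (y x) - F x = - integral {y x..x} f"
          using comb[of "y x" x] xE[OF x] y(1)[OF x] by (simp add: algebra_simps)
        then have "F (y x) - F x - (y x - x) *\<^sub>R f x = (x - y x) *\<^sub>R f x - integral {y x..x} f"
          by (simp add: algebra_simps)
        then show ?thesis using False unfolding J
          by (simp add: min_def max_def)
      qed
      with y(4)[OF x] have "\<bar>y x - x\<bar> / real (Suc k) < norm (measure lborel (cball (c x) (r x)) *\<^sub>R f x - integral (cball (c x) (r x)) f)"
        by simp
      then have "\<bar>y x - x\<bar> \<le> real (Suc k) * norm (measure lborel (cball (c x) (r x)) *\<^sub>R f x - integral (cball (c x) (r x)) f)"
        by (simp add: pos_divide_less_eq mult.commute del: of_nat_Suc)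
      then show ?thesis by (simp add: r_def)
    qed
    obtain C where C: "countable C" "C \<subseteq> E k"
      "pairwise (\<lambda>i j. disjnt (cball (c i) (r i)) (cball (c j) (r j))) C"
      "E k \<subseteq> (\<Union>i\<in>C. cball (c i) (5 * r i))"
      by (rule Vitali_covering_lemma_cballs[where S = "E k" and K = "E k" and a = c and r = r and B = "b - a"]) (use xJ r in auto)
    \<comment> \<open>Henstock's lemma concerns finite families: disjoint intervals, each tagged by
      its endpoint \<open>x\<close>, form a partial division. The bound is uniform over finite
      \<open>C'\<close>, so it holds for the countable cover too.\<close>
    have fin: "measure lebesgue (\<Union>i\<in>C'. cball (c i) (5 * r i)) \<le> e" if C': "C' \<subseteq> C" "finite C'" for C'
    proof -
      let ?J = "\<lambda>x. cball (c x) (r x)"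
      let ?p = "(\<lambda>x. (x, ?J x)) ` C'"
      have inj: "inj_on (\<lambda>x. (x, ?J x)) C'" by (auto simp: inj_on_def)
      have disj: "?J i \<inter> ?J j = {}" if "i \<in> C'" "j \<in> C'" "i \<noteq> j" for i j
        using C(3) C'(1) that unfolding pairwise_def disjnt_def by blast
      have "?p tagged_partial_division_of (cbox a b)"
        unfolding tagged_partial_division_of_def
      proof (intro conjI allI impI)
        show "finite ?p" using C' by simp
      next
        fix x K assume "(x, K) \<in> ?p"
        then have x: "x \<in> E k" "K = ?J x" using C' C(2) by auto
        show "x \<in> K" using xJ x by simp
        show "K \<subseteq> cbox a b" using x(2) xE[OF x(1)] y(1)[OF x(1)] unfolding J by auto
        show "\<exists>a b. K = cbox a b" using x(2) unfolding J by auto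
      next
        fix x1 K1 x2 K2
        assume "(x1, K1) \<in> ?p \<and> (x2, K2) \<in> ?p \<and> (x1, K1) \<noteq> (x2, K2)"
        then have "K1 \<inter> K2 = {}" using disj by auto
        then show "interior K1 \<inter> interior K2 = {}" using interior_subset by blast
      qed
      moreover have "\<gamma> fine ?p"
        using y(3) C' C(2) by (auto simp: fine_def c_def r_def)
      ultimately have "(\<Sum>(x,k)\<in>?p. norm (measure lborel k *\<^sub>R f x - integral k f)) < e'" by (rule H)
      then have *: "(\<Sum>x\<in>C'. norm (measure lborel (?J x) *\<^sub>R f x - integral (?J x) f)) < e'"
        by (simp add: sum.reindex[OF inj])
      have "measure lebesgue (\<Union>i\<in>C'. cball (c i) (5 * r i)) \<le> (\<Sum>i\<in>C'. measure lebesgue (cball (c i) (5 * r i)))"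
        using C' by (intro measure_UNION_le) auto
      also have "\<dots> = (\<Sum>i\<in>C'. 5 * (2 * r i))"
        using r C' C(2) by (intro sum.cong) (auto simp: cball_eq_atLeastAtMost intro: less_imp_le)
      also have "\<dots> \<le> (\<Sum>i\<in>C'. 5 * (real (Suc k) * norm (measure lborel (?J i) *\<^sub>R f i - integral (?J i) f)))"
        using err C' C(2) by (intro sum_mono mult_left_mono) auto
      also have "\<dots> = 5 * real (Suc k) * (\<Sum>x\<in>C'. norm (measure lborel (?J x) *\<^sub>R f x - integral (?J x) f))"
        by (simp only: sum_distrib_left mult.assoc)
      also have "\<dots> \<le> 5 * real (Suc k) * e'"
        using * by (intro mult_left_mono) auto
      also have "\<dots> = e" by (simp add: e'_def)
      finally show ?thesis .
    qed
    show "\<exists>T. E k \<subseteq> T \<and> T \<in> lmeasurable \<and> measure lebesgue T \<le> e"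
    proof (intro exI conjI)
      show "E k \<subseteq> (\<Union>i\<in>C. cball (c i) (5 * r i))" by (rule C(4))
      show "(\<Union>i\<in>C. cball (c i) (5 * r i)) \<in> lmeasurable"
        by (rule fmeasurable_UN_bound[OF C(1) _ fin]) auto
      show "measure lebesgue (\<Union>i\<in>C. cball (c i) (5 * r i)) \<le> e"
        by (rule measure_UN_bound[OF C(1) _ fin]) auto
    qed
  qed
  have "{x \<in> {a<..<b}. \<not> (F has_vector_derivative f x) (at x)} \<subseteq> (\<Union>k. E k)"
  proof (rule subsetI, rule ccontr)
    fix x assume x: "x \<in> {x \<in> {a<..<b}. \<not> (F has_vector_derivative f x) (at x)}" and nE: "x \<notin> (\<Union>k. E k)"
    have "(F has_vector_derivative f x) (at x)"
      unfolding has_vector_derivative_def has_derivative_at_alt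
    proof (intro conjI allI impI)
      show "bounded_linear (\<lambda>h. h *\<^sub>R f x)" by (rule bounded_linear_scaleR_left)
      fix \<epsilon> :: real assume "\<epsilon> > 0"
      then obtain k where k: "1 / real (Suc k) < \<epsilon>" using nat_approx_posE by blast
      have "x \<notin> E k" using nE by blast
      then obtain d where d: "d > 0" "\<And>y. y \<in> {a<..<b} \<Longrightarrow> y \<noteq> x \<Longrightarrow> \<bar>y - x\<bar> < d \<Longrightarrow>
        norm (F y - F x - (y - x) *\<^sub>R f x) \<le> \<bar>y - x\<bar> / real (Suc k)"
        using x unfolding E_def by (simp add: not_less del: of_nat_Suc) (meson leD not_less)
      show "\<exists>d>0. \<forall>y. norm (y - x) < d \<longrightarrow> norm (F y - F x - (y - x) *\<^sub>R f x) \<le> \<epsilon> * norm (y - x)"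
      proof (intro exI[of _ "min d (min (x - a) (b - x))"] conjI allI impI)
        show "min d (min (x - a) (b - x)) > 0" using d x by auto
        fix y assume y: "norm (y - x) < min d (min (x - a) (b - x))"
        show "norm (F y - F x - (y - x) *\<^sub>R f x) \<le> \<epsilon> * norm (y - x)"
        proof (cases "y = x")
          case False
          have "norm (F y - F x - (y - x) *\<^sub>R f x) \<le> \<bar>y - x\<bar> / real (Suc k)"
            using y False by (intro d(2)) auto
          also have "\<dots> = (1 / real (Suc k)) * norm (y - x)" by simp
          also have "\<dots> \<le> \<epsilon> * norm (y - x)" using k by (intro mult_right_mono) auto
          finally show ?thesis .
        qed simp
      qed
    qed
    with x show False by simp
  qed
  moreover have "negligible (\<Union>k. E k)" by (intro negligible_Union_nat neg)
  ultimately show ?thesis unfolding F_def by (rule negligible_subset[rotated])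
qed

text \<open>The density obtained from measures is identified with the pointwise derivative that
  enters \<open>hadamard_deriv\<close>.\<close>

lemma AC_fundamental_theorem:
  fixes u :: "real \<Rightarrow> 'a::euclidean_space"
  assumes u: "u \<in> AC a b" and ab: "a \<le> b"
  obtains g where "integrable lborel g"
    "\<And>t. t \<in> {a..b} \<Longrightarrow> u t - u a = (LINT x:{a..t}|lborel. g x)"
    "AE x in lebesgue. x \<in> {a<..<b} \<longrightarrow> (u has_vector_derivative g x) (at x)"
proof -
  obtain g where g: "integrable lborel g"
    "\<And>t. t \<in> {a..b} \<Longrightarrow> u t - u a = (LINT x:{a..t}|lborel. g x)"
    by (rule AC_density[OF u ab]) (rule that)
  have si: "set_integrable lborel {a..t} g" for t
    unfolding set_integrable_def using g(1) by (intro integrable_mult_indicator) auto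
  have eq: "u t = u a + integral {a..t} g" if "t \<in> {a..b}" for t
    using g(2)[OF that] set_borel_integral_eq_integral(2)[OF si, of t] by (simp add: algebra_simps)
  let ?N = "{x \<in> {a<..<b}. \<not> ((\<lambda>t. integral {a..t} g) has_vector_derivative g x) (at x)}"
  have "negligible ?N"
    by (rule has_vector_derivative_indefinite_integral_AE) (rule set_borel_integral_eq_integral(1)[OF si])
  then have "AE x in lebesgue. x \<notin> ?N"
    by (intro AE_not_in) (simp add: negligible_iff_null_sets)
  moreover have "(u has_vector_derivative g x) (at x)" if x: "x \<in> {a<..<b}" "x \<notin> ?N" for x
  proof -
    have "((\<lambda>t. u a + integral {a..t} g) has_vector_derivative g x) (at x)"
      using x by (auto intro!: derivative_eq_intros)
    then show ?thesis
    proof (rule has_vector_derivative_transform_within_open)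
      show "open {a<..<b}" "x \<in> {a<..<b}" using x by auto
      show "u a + integral {a..y} g = u y" if "y \<in> {a<..<b}" for y
        using that by (intro eq[symmetric]) auto
    qed
  qed
  ultimately have "AE x in lebesgue. x \<in> {a<..<b} \<longrightarrow> (u has_vector_derivative g x) (at x)"
    by (elim eventually_mono) blast
  with g that show thesis by blast
qed

section \<open>Hoelder's inequality and the Beta integral\<close>

text \<open>Young's inequality, applied to \<open>f / F\<close> and \<open>g / G\<close> and
  integrated. It is stated for the integrable functions themselves, so that p-th powers of norms can
  be inserted directly, with the reciprocals of the Hoelder exponents as \<open>\<theta>\<close> and
  \<open>1 - \<theta>\<close>.\<close>

lemma Holder_powr:
  fixes f g :: "'a \<Rightarrow> real"
  assumes f: "integrable M f" "\<And>x. 0 \<le> f x" and g: "integrable M g" "\<And>x. 0 \<le> g x"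
    and \<theta>: "0 < \<theta>" "\<theta> < 1"
  shows "integrable M (\<lambda>x. f x powr \<theta> * g x powr (1 - \<theta>))"
    and "(LINT x|M. f x powr \<theta> * g x powr (1 - \<theta>)) \<le> (LINT x|M. f x) powr \<theta> * (LINT x|M. g x) powr (1 - \<theta>)"
proof -
  have young: "x powr \<theta> * y powr (1 - \<theta>) \<le> \<theta> * x + (1 - \<theta>) * y" if "0 \<le> x" "0 \<le> y" for x y :: real
    using Youngs_inequality_0[of \<theta> "1 - \<theta>" x y] that \<theta> by (cases "x = 0 \<or> y = 0") auto
  have [measurable]: "f \<in> borel_measurable M" "g \<in> borel_measurable M" using f g by auto
  have "integrable M (\<lambda>x. \<theta> * f x + (1 - \<theta>) * g x)" using f g by auto
  then show int: "integrable M (\<lambda>x. f x powr \<theta> * g x powr (1 - \<theta>))"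
    by (rule Bochner_Integration.integrable_bound) (use young f g in \<open>auto intro!: AE_I2 order_trans[OF young]\<close>)
  define F G where "F = (LINT x|M. f x)" and "G = (LINT x|M. g x)"
  have FG: "F \<ge> 0" "G \<ge> 0" unfolding F_def G_def using f g by (auto intro: integral_nonneg_AE)
  show "(LINT x|M. f x powr \<theta> * g x powr (1 - \<theta>)) \<le> F powr \<theta> * G powr (1 - \<theta>)"
  \<comment> \<open>Normalisation is impossible if an integral vanishes, but then one function, and
    with it the product, is 0 almost everywhere.\<close>
  proof (cases "F = 0 \<or> G = 0")
    case True
    then have "(AE x in M. f x = 0) \<or> (AE x in M. g x = 0)"
      using integral_nonneg_eq_0_iff_AE[OF f(1)] integral_nonneg_eq_0_iff_AE[OF g(1)] f(2) g(2)
      by (auto simp: F_def G_def)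
    then have "AE x in M. f x powr \<theta> * g x powr (1 - \<theta>) = 0"
      by (auto elim!: eventually_mono)
    then have "(LINT x|M. f x powr \<theta> * g x powr (1 - \<theta>)) = 0" by (rule integral_eq_zero_AE)
    then show ?thesis by simp
  next
    case False
    then have pos: "F > 0" "G > 0" using FG by auto
    define c where "c = F powr \<theta> * G powr (1 - \<theta>)"
    have c: "c > 0" using pos by (simp add: c_def)
    have "f x powr \<theta> * g x powr (1 - \<theta>) \<le> c * (\<theta> * (f x / F) + (1 - \<theta>) * (g x / G))" for x
    proof -
      have "f x powr \<theta> * g x powr (1 - \<theta>) = c * ((f x / F) powr \<theta> * (g x / G) powr (1 - \<theta>))"
        using pos f(2) g(2) by (simp add: c_def powr_divide)
      also have "\<dots> \<le> c * (\<theta> * (f x / F) + (1 - \<theta>) * (g x / G))"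
        using c pos f(2) g(2) by (intro mult_left_mono young) auto
      finally show ?thesis .
    qed
    then have "(LINT x|M. f x powr \<theta> * g x powr (1 - \<theta>)) \<le> (LINT x|M. c * (\<theta> * (f x / F) + (1 - \<theta>) * (g x / G)))"
      using int f g by (intro integral_mono) auto
    also have "\<dots> = c * (\<theta> * (F / F) + (1 - \<theta>) * (G / G))"
      using f g by (simp add: F_def G_def)
    also have "\<dots> = c" using pos by simp
    finally show ?thesis by (simp add: c_def)
  qed
qed

text \<open>The substitution \<open>s = \<tau> * exp (L * v)\<close> with
  \<open>L = ln (t / \<tau>)\<close> turns the two logarithms into \<open>L * v\<close> and
  \<open>L * (1 - v)\<close> and \<open>ds / s\<close> into \<open>L dv\<close>, which leaves
  Euler's integral. The inversion uses \<open>x = 1 - \<alpha>\<close>, \<open>y = \<alpha>\<close>;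
  setting one parameter to 1 gives the masses of the kernel.\<close>

lemma nn_integral_ln_powr_Beta:
  fixes \<tau> t x y :: real
  assumes \<tau>: "0 < \<tau>" "\<tau> < t" and xy: "0 < x" "0 < y"
  shows "(\<integral>\<^sup>+s. ennreal (indicator {\<tau><..<t} s * (ln (s / \<tau>) powr (x - 1) * ln (t / s) powr (y - 1) / s)) \<partial>lborel)
      = ennreal (ln (t / \<tau>) powr (x + y - 1) * Beta x y)"
proof -
  define L where "L = ln (t / \<tau>)"
  have L: "L > 0" using \<tau> by (simp add: L_def)
  define f where "f s = ln (s / \<tau>) powr (x - 1) * ln (t / s) powr (y - 1) / s" for s
  have fm[measurable]: "f \<in> borel_measurable borel" unfolding f_def by measurable
  let ?g = "\<lambda>v. \<tau> * exp (L * v)" and ?g' = "\<lambda>v. \<tau> * L * exp (L * v)"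
  have g01: "?g 0 = \<tau>" "?g 1 = t" using \<tau> by (auto simp: L_def)
  \<comment> \<open>At the endpoints one logarithm is 0, and \<open>0 powr z = 0\<close> for every
    \<open>z\<close>, so the open and the closed interval give the same integrand.\<close>
  have "(\<integral>\<^sup>+s. ennreal (indicator {\<tau><..<t} s * f s) \<partial>lborel) = (\<integral>\<^sup>+s. ennreal (f s * indicator {?g 0..?g 1} s) \<partial>lborel)"
    unfolding g01 using \<tau> by (intro nn_integral_cong) (auto simp: f_def indicator_def)
  also have "\<dots> = (\<integral>\<^sup>+v. ennreal (f (?g v) * ?g' v * indicator {0..1} v) \<partial>lborel)"
    by (rule nn_integral_substitution)
      (use L \<tau> in \<open>auto simp: set_borel_measurable_def intro!: derivative_eq_intros continuous_intros\<close>)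
  also have "\<dots> = (\<integral>\<^sup>+v. ennreal (L powr (x + y - 1)) * ennreal (indicator {0..1} v * (v powr (x - 1) * (1 - v) powr (y - 1))) \<partial>lborel)"
  proof (intro nn_integral_cong)
    fix v :: real
    have "f (?g v) * ?g' v = L powr (x + y - 1) * (v powr (x - 1) * (1 - v) powr (y - 1))" if v: "v \<in> {0..1}"
    proof -
      have 1: "ln (?g v / \<tau>) = L * v" using \<tau> by simp
      have "ln (t / ?g v) = ln (t / \<tau>) - ln (exp (L * v))"
        using \<tau> by (simp add: ln_div ln_mult)
      then have 2: "ln (t / ?g v) = L * (1 - v)" by (simp add: L_def algebra_simps)
      have "f (?g v) * ?g' v = (L * v) powr (x - 1) * (L * (1 - v)) powr (y - 1) * L"
        unfolding f_def 1 2 using \<tau> by simp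
      also have "\<dots> = (L powr (x - 1) * L powr (y - 1) * L) * (v powr (x - 1) * (1 - v) powr (y - 1))"
        using v L by (simp add: powr_mult)
      also have "L powr (x - 1) * L powr (y - 1) * L = L powr (x + y - 1)"
      proof -
        have "L powr (x - 1) * L powr (y - 1) * L = L powr (x - 1 + (y - 1) + 1)"
          using L by (simp only: powr_add powr_one less_imp_le)
        then show ?thesis by (simp add: algebra_simps)
      qed
      finally show ?thesis .
    qed
    then show "ennreal (f (?g v) * ?g' v * indicator {0..1} v) = ennreal (L powr (x + y - 1)) * ennreal (indicator {0..1} v * (v powr (x - 1) * (1 - v) powr (y - 1)))"
      by (auto simp: indicator_def ennreal_mult')
  qed
  also have "\<dots> = ennreal (L powr (x + y - 1)) * (\<integral>\<^sup>+v. ennreal (indicator {0..1} v * (v powr (x - 1) * (1 - v) powr (y - 1))) \<partial>lborel)"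
    by (rule nn_integral_cmult) measurable
  also have "(\<integral>\<^sup>+v. ennreal (indicator {0..1} v * (v powr (x - 1) * (1 - v) powr (y - 1))) \<partial>lborel) = ennreal (Beta x y)"
    using nn_integral_has_integral_lebesgue[OF _ has_integral_Beta_real[OF xy]] by simp
  finally show ?thesis by (simp add: L_def f_def ennreal_mult')
qed

lemma Beta_real_pos: "0 < (x::real) \<Longrightarrow> 0 < y \<Longrightarrow> 0 < Beta x y"
  by (simp add: Beta_def Gamma_real_pos)

section \<open>Inversion of the Hadamard derivative\<close>

text \<open>
  Composing the fractional integral with the fractional derivative: by Fubini the kernel of the
  composition is a Beta integral, hence constant.
\<close>

lemma norm_integral_le_Abel:
  fixes g :: "real \<Rightarrow> 'a::euclidean_space"
  assumes g: "integrable lborel g" and \<alpha>: "0 < \<alpha>" "\<alpha> < 1" and a: "0 < a" "a < t"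
    and D: "D = (\<lambda>s. LINT \<tau>|lborel. (indicator {a<..<s} \<tau> * ln (s / \<tau>) powr (- \<alpha>)) *\<^sub>R g \<tau>)"
  shows "ennreal (Beta (1 - \<alpha>) \<alpha> * norm (LINT x:{a..t}|lborel. g x))
    \<le> (\<integral>\<^sup>+s. ennreal (indicator {a<..<t} s * (ln (t / s) powr (\<alpha> - 1) / s) * norm (D s)) \<partial>lborel)"
proof -
  have [measurable]: "g \<in> borel_measurable borel" using g by auto
  define B where "B = Beta (1 - \<alpha>) \<alpha>"
  have B: "B > 0" using \<alpha> by (simp add: B_def Beta_real_pos)
  define K where "K s \<tau> = (if a < \<tau> \<and> \<tau> < s \<and> s < t then ln (s / \<tau>) powr (- \<alpha>) * ln (t / s) powr (\<alpha> - 1) / s else 0)" for s \<tau>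
  have K0: "K s \<tau> \<ge> 0" for s \<tau> using a by (auto simp: K_def)
  have [measurable]: "(\<lambda>(s, \<tau>). K s \<tau>) \<in> borel_measurable (borel \<Otimes>\<^sub>M borel)" unfolding K_def by measurable
  \<comment> \<open>The exponents of the Beta integral add up so that \<open>ln (t / \<tau>)\<close>
    appears with power 0: the mass depends neither on \<open>\<tau>\<close> nor on
    \<open>t\<close>.\<close>
  have K1: "(\<integral>\<^sup>+s. ennreal (K s \<tau>) \<partial>lborel) = ennreal (B * indicator {a<..<t} \<tau>)" for \<tau>
  proof (cases "a < \<tau> \<and> \<tau> < t")
    case True
    have "(\<integral>\<^sup>+s. ennreal (K s \<tau>) \<partial>lborel) = (\<integral>\<^sup>+s. ennreal (indicator {\<tau><..<t} s *
        (ln (s / \<tau>) powr ((1 - \<alpha>) - 1) * ln (t / s) powr (\<alpha> - 1) / s)) \<partial>lborel)"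
      using True by (intro nn_integral_cong) (auto simp: K_def indicator_def)
    also have "\<dots> = ennreal (ln (t / \<tau>) powr (1 - \<alpha> + \<alpha> - 1) * B)"
      unfolding B_def using True \<alpha> a by (intro nn_integral_ln_powr_Beta) auto
    also have "\<dots> = ennreal B" using True a by simp
    finally show ?thesis using True by simp
  next
    case False
    then have "K s \<tau> = 0" for s by (auto simp: K_def)
    then show ?thesis using False by auto
  qed
  \<comment> \<open>Integrating the norm over \<open>s\<close> first costs only the factor
    \<open>B\<close>, so integrability of \<open>g\<close> suffices for Fubini despite the singular
    kernel.\<close>
  have int: "integrable (lborel \<Otimes>\<^sub>M lborel) (\<lambda>(s, \<tau>). K s \<tau> *\<^sub>R g \<tau>)"
  proof (rule integrableI_bounded)
    have "(\<integral>\<^sup>+x. ennreal (norm (case x of (s, \<tau>) \<Rightarrow> K s \<tau> *\<^sub>R g \<tau>)) \<partial>(lborel \<Otimes>\<^sub>M lborel))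
        = (\<integral>\<^sup>+\<tau>. \<integral>\<^sup>+s. ennreal (norm (K s \<tau> *\<^sub>R g \<tau>)) \<partial>lborel \<partial>lborel)"
      by (subst lborel_pair.nn_integral_snd[symmetric]) auto
    also have "\<dots> = (\<integral>\<^sup>+\<tau>. ennreal (B * indicator {a<..<t} \<tau>) * ennreal (norm (g \<tau>)) \<partial>lborel)"
      using K0 by (intro nn_integral_cong) (simp add: ennreal_mult' nn_integral_multc K1)
    also have "\<dots> \<le> (\<integral>\<^sup>+\<tau>. ennreal B * ennreal (norm (g \<tau>)) \<partial>lborel)"
      using B by (intro nn_integral_mono mult_right_mono) (auto simp: indicator_def)
    also have "\<dots> = ennreal B * (\<integral>\<^sup>+\<tau>. ennreal (norm (g \<tau>)) \<partial>lborel)" by (rule nn_integral_cmult) auto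
    also have "\<dots> < \<infinity>" using g by (auto simp: integrable_iff_bounded ennreal_mult_less_top)
    finally show "(\<integral>\<^sup>+x. ennreal (norm (case x of (s, \<tau>) \<Rightarrow> K s \<tau> *\<^sub>R g \<tau>)) \<partial>(lborel \<Otimes>\<^sub>M lborel)) < \<infinity>" .
  qed auto
  have "B *\<^sub>R (LINT x:{a..t}|lborel. g x) = B *\<^sub>R (LINT x|lborel. indicator {a<..<t} x *\<^sub>R g x)"
  proof -
    have "AE x in lborel. x \<noteq> a" "AE x in lborel. x \<noteq> t" by (rule AE_lborel_singleton)+
    then have "AE x in lborel. indicator {a..t} x *\<^sub>R g x = indicator {a<..<t} x *\<^sub>R g x"
      by eventually_elim (auto simp: indicator_def)
    then show ?thesis unfolding set_lebesgue_integral_def by (intro arg_cong[where f = "scaleR B"] integral_cong_AE) auto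
  qed
  also have "\<dots> = (LINT \<tau>|lborel. LINT s|lborel. K s \<tau> *\<^sub>R g \<tau>)"
  proof -
    have "(LINT s|lborel. K s \<tau>) = B * indicator {a<..<t} \<tau>" for \<tau>
      using K0 K1[of \<tau>] B by (subst integral_eq_nn_integral) auto
    moreover have "integrable lborel (\<lambda>s. K s \<tau>)" for \<tau>
      using K0 K1[of \<tau>] by (intro integrableI_nonneg) auto
    ultimately have "(LINT s|lborel. K s \<tau> *\<^sub>R g \<tau>) = B *\<^sub>R (indicator {a<..<t} \<tau> *\<^sub>R g \<tau>)" for \<tau> by simp
    then show ?thesis by (simp only: integral_scaleR_right)
  qed
  also have "\<dots> = (LINT s|lborel. LINT \<tau>|lborel. K s \<tau> *\<^sub>R g \<tau>)"
    using lborel_pair.Fubini_integral[OF int] by simp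
  finally have eq: "B *\<^sub>R (LINT x:{a..t}|lborel. g x) = (LINT s|lborel. LINT \<tau>|lborel. K s \<tau> *\<^sub>R g \<tau>)" .
  have inner: "(LINT \<tau>|lborel. K s \<tau> *\<^sub>R g \<tau>) = (indicator {a<..<t} s * (ln (t / s) powr (\<alpha> - 1) / s)) *\<^sub>R D s" for s
  proof -
    have "(LINT \<tau>|lborel. K s \<tau> *\<^sub>R g \<tau>) = (LINT \<tau>|lborel. (indicator {a<..<t} s * (ln (t / s) powr (\<alpha> - 1) / s)) *\<^sub>R
        ((indicator {a<..<s} \<tau> * ln (s / \<tau>) powr (- \<alpha>)) *\<^sub>R g \<tau>))"
      by (intro Bochner_Integration.integral_cong) (auto simp: K_def indicator_def)
    then show ?thesis unfolding D by (simp only: integral_scaleR_right)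
  qed
  have "ennreal (B * norm (LINT x:{a..t}|lborel. g x)) = ennreal (norm (LINT s|lborel. LINT \<tau>|lborel. K s \<tau> *\<^sub>R g \<tau>))"
    unfolding eq[symmetric] using B by simp
  also have "\<dots> \<le> (\<integral>\<^sup>+s. ennreal (norm (LINT \<tau>|lborel. K s \<tau> *\<^sub>R g \<tau>)) \<partial>lborel)"
    using lborel_pair.integrable_fst'[OF int] by (intro integral_norm_bound_ennreal) simp
  also have "\<dots> = (\<integral>\<^sup>+s. ennreal (indicator {a<..<t} s * (ln (t / s) powr (\<alpha> - 1) / s) * norm (D s)) \<partial>lborel)"
    unfolding inner using a by (intro nn_integral_cong) (auto simp: indicator_def)
  finally show ?thesis by (simp add: B_def)
qed

text \<open>The pointwise half of Schur's test: Hoelder's inequality for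
  \<open>k * h = (k * h powr p) powr (1 / p) * k powr (1 - 1 / p)\<close>, where the second factor
  is controlled by the mass bound \<open>\<kappa>\<close>.\<close>

lemma powr_le_nn_integral_kernel:
  fixes k h :: "'a \<Rightarrow> real"
  assumes [measurable]: "k \<in> borel_measurable M" "h \<in> borel_measurable M"
    and nonneg: "\<And>x. 0 \<le> k x" "\<And>x. 0 \<le> h x"
    and \<kappa>: "(\<integral>\<^sup>+x. ennreal (k x) \<partial>M) \<le> ennreal \<kappa>" "0 < \<kappa>" and p: "1 < p"
    and X: "0 \<le> X" "ennreal X \<le> (\<integral>\<^sup>+x. ennreal (k x * h x) \<partial>M)"
  shows "ennreal (X powr p) \<le> ennreal (\<kappa> powr (p - 1)) * (\<integral>\<^sup>+x. ennreal (k x * h x powr p) \<partial>M)"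
proof (cases "(\<integral>\<^sup>+x. ennreal (k x * h x powr p) \<partial>M) = \<infinity>")
  case True
  \<comment> \<open>Positivity of \<open>\<kappa>\<close> matters, as
    \<open>0 * \<infinity> = 0\<close> in \<open>ennreal\<close>.\<close>
  then show ?thesis using \<kappa>(2) by (simp add: ennreal_mult_top)
next
  case False
  define \<theta> where "\<theta> = 1 / p"
  have \<theta>: "0 < \<theta>" "\<theta> < 1" "\<theta> * p = 1" using p by (auto simp: \<theta>_def)
  have kp: "integrable M (\<lambda>x. k x * h x powr p)"
    using False nonneg by (intro integrableI_nonneg) (auto simp: less_top)
  have k: "integrable M k" using \<kappa>(1) nonneg by (intro integrableI_nonneg) (auto intro: le_less_trans)
  have eq: "(k x * h x powr p) powr \<theta> * k x powr (1 - \<theta>) = k x * h x" for x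
  proof -
    have "(k x * h x powr p) powr \<theta> * k x powr (1 - \<theta>) = (k x powr \<theta> * k x powr (1 - \<theta>)) * h x powr (p * \<theta>)"
      using nonneg[of x] by (simp add: powr_mult powr_powr)
    also have "\<dots> = k x * h x" using nonneg[of x] \<theta> by (simp add: powr_add[symmetric] mult.commute)
    finally show ?thesis .
  qed
  have hold: "integrable M (\<lambda>x. k x * h x)"
    "(LINT x|M. k x * h x) \<le> (LINT x|M. k x * h x powr p) powr \<theta> * (LINT x|M. k x) powr (1 - \<theta>)"
    using Holder_powr[OF kp _ k nonneg(1) \<theta>(1,2)] nonneg by (simp_all add: eq)
  have I0: "0 \<le> (LINT x|M. k x * h x powr p)" using nonneg by (intro integral_nonneg_AE) auto
  have "ennreal X \<le> ennreal (LINT x|M. k x * h x)"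
    using X(2) nonneg hold(1) by (simp add: nn_integral_eq_integral)
  then have "X \<le> (LINT x|M. k x * h x)"
    using nonneg by (subst (asm) ennreal_le_iff) (auto intro: integral_nonneg_AE)
  also note hold(2)
  also have "(LINT x|M. k x * h x powr p) powr \<theta> * (LINT x|M. k x) powr (1 - \<theta>)
      \<le> (LINT x|M. k x * h x powr p) powr \<theta> * \<kappa> powr (1 - \<theta>)"
  proof (intro mult_left_mono powr_mono2)
    have "ennreal (LINT x|M. k x) \<le> ennreal \<kappa>" using \<kappa>(1) k nonneg by (simp add: nn_integral_eq_integral)
    then show "(LINT x|M. k x) \<le> \<kappa>" using \<kappa>(2) by (simp add: ennreal_le_iff)
  qed (use \<theta> nonneg in \<open>auto intro: integral_nonneg_AE\<close>)
  finally have "X powr p \<le> ((LINT x|M. k x * h x powr p) powr \<theta> * \<kappa> powr (1 - \<theta>)) powr p"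
    using X p by (intro powr_mono2) auto
  also have "\<dots> = (LINT x|M. k x * h x powr p) * \<kappa> powr (p - 1)"
    using I0 \<theta> by (simp add: powr_mult powr_powr algebra_simps)
  finally have "ennreal (X powr p) \<le> ennreal (\<kappa> powr (p - 1) * (LINT x|M. k x * h x powr p))"
    by (intro ennreal_leI) (simp add: mult.commute)
  then show ?thesis
    using nn_integral_eq_integral[OF kp] nonneg I0 by (simp add: ennreal_mult' del: ennreal_mult'')
qed

text \<open>The factors \<open>s\<close> and \<open>1 / s\<close> of the definition cancel, and
  undefined derivatives sit on a null set. Replacing them by \<open>g\<close> moves the integral
  from \<open>lebesgue\<close> to \<open>lborel\<close>, where product measurability and Fubini are
  at hand.\<close>

lemma hadamard_deriv_eq:
  fixes u :: "real \<Rightarrow> 'a::euclidean_space"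
  assumes g: "integrable lborel g" and s: "s \<in> {a<..<b}" and a: "0 < a"
    and deriv: "AE x in lebesgue. x \<in> {a<..<b} \<longrightarrow> (u has_vector_derivative g x) (at x)"
  shows "hadamard_deriv a \<alpha> u s = (1 / Gamma (1 - \<alpha>)) *\<^sub>R
    (LINT \<tau>|lborel. (indicator {a<..<s} \<tau> * ln (s / \<tau>) powr (- \<alpha>)) *\<^sub>R g \<tau>)"
proof -
  have [measurable]: "g \<in> borel_measurable borel" using g by auto
  let ?f = "\<lambda>\<tau>. indicator {a<..<s} \<tau> *\<^sub>R
      ((ln (s / \<tau>) powr (- \<alpha>)) *\<^sub>R (\<tau> *\<^sub>R vector_derivative u (at \<tau>)) /\<^sub>R \<tau>)"
  let ?h = "\<lambda>\<tau>. (indicator {a<..<s} \<tau> * ln (s / \<tau>) powr (- \<alpha>)) *\<^sub>R g \<tau>"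
  have hm: "?h \<in> borel_measurable lborel" by measurable
  have ae: "AE \<tau> in lebesgue. ?h \<tau> = ?f \<tau>"
    using deriv
  proof eventually_elim
    case (elim \<tau>)
    show ?case
    proof (cases "\<tau> \<in> {a<..<s}")
      case True
      then have "vector_derivative u (at \<tau>) = g \<tau>" "\<tau> \<noteq> 0"
        using elim s a by (auto intro: vector_derivative_at)
      then show ?thesis by simp
    qed simp
  qed
  have "?f \<in> borel_measurable lebesgue"
    using borel_measurable_AE[OF measurable_completion[OF hm] ae] .
  then have "integral\<^sup>L lebesgue ?f = integral\<^sup>L lebesgue ?h"
    using ae measurable_completion[OF hm] by (intro integral_cong_AE) (auto simp: eq_commute)
  also have "\<dots> = integral\<^sup>L lborel ?h" by (rule integral_completion[OF hm])
  finally show ?thesis unfolding hadamard_deriv_def set_lebesgue_integral_def by (simp only:)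
qed

text \<open>Schur's test for the kernel \<open>ln (t / s) powr (\<alpha> - 1) / s\<close> of the fractional integral.\<close>

lemma Lp_norm_le_hadamard_deriv:
  fixes a b \<alpha> p :: real
  assumes ab: "0 < a" "a < b" and \<alpha>: "0 < \<alpha>" "\<alpha> < 1" and p: "1 < p"
  shows "\<exists>C>0. \<forall>u :: real \<Rightarrow> 'a::euclidean_space. u \<in> AC a b \<longrightarrow> u a = 0 \<longrightarrow>
    (\<integral>\<^sup>+x. ennreal (indicator {a<..<b} x * norm (u x) powr p) \<partial>lborel)
    \<le> ennreal C * (\<integral>\<^sup>+x. ennreal (indicator {a<..<b} x * norm (hadamard_deriv a \<alpha> u x) powr p) \<partial>lborel)"
proof -
  define B \<Gamma> L where "B = Beta (1 - \<alpha>) \<alpha>" and "\<Gamma> = Gamma (1 - \<alpha>)" and "L = ln (b / a)"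
  \<comment> \<open>\<open>\<kappa>\<^sub>1\<close> bounds the integral of the kernel over
    \<open>s\<close> and \<open>\<kappa>\<^sub>2\<close> the one over \<open>t\<close>, with
    \<open>L\<close> as the largest logarithm. In \<open>C\<close>, the part with
    \<open>\<kappa>\<^sub>1\<close> and \<open>B\<close> comes from the pointwise estimate, the part
    with \<open>\<kappa>\<^sub>2\<close> and \<open>\<Gamma>\<close> from the second
    integration.\<close>
  define \<kappa>\<^sub>1 \<kappa>\<^sub>2 where "\<kappa>\<^sub>1 = L powr \<alpha> * Beta 1 \<alpha>" and "\<kappa>\<^sub>2 = (b / a) * (L powr \<alpha> * Beta \<alpha> 1)"
  define C where "C = \<kappa>\<^sub>1 powr (p - 1) / B powr p * (\<kappa>\<^sub>2 * \<Gamma> powr p)"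
  have pos: "B > 0" "\<Gamma> > 0" "L > 0" "\<kappa>\<^sub>1 > 0" "\<kappa>\<^sub>2 > 0"
    using ab \<alpha> by (simp_all add: B_def \<Gamma>_def L_def \<kappa>\<^sub>1_def \<kappa>\<^sub>2_def Beta_real_pos Gamma_real_pos)
  define k where "k t s = (if a < s \<and> s < t \<and> t < b then ln (t / s) powr (\<alpha> - 1) / s else 0)" for t s :: real
  have k0: "k t s \<ge> 0" for t s using ab by (auto simp: k_def)
  have km[measurable]: "(\<lambda>(t, s). k t s) \<in> borel_measurable (borel \<Otimes>\<^sub>M borel)" unfolding k_def by measurable
  have k1: "(\<integral>\<^sup>+s. ennreal (k t s) \<partial>lborel) \<le> ennreal \<kappa>\<^sub>1" if t: "t \<in> {a<..<b}" for t
  proof -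
    have "(\<integral>\<^sup>+s. ennreal (k t s) \<partial>lborel) = (\<integral>\<^sup>+s. ennreal (indicator {a<..<t} s *
        (ln (s / a) powr (1 - 1) * ln (t / s) powr (\<alpha> - 1) / s)) \<partial>lborel)"
      using t ab by (intro nn_integral_cong) (auto simp: k_def indicator_def)
    also have "\<dots> = ennreal (ln (t / a) powr (1 + \<alpha> - 1) * Beta 1 \<alpha>)"
      using t \<alpha> ab by (intro nn_integral_ln_powr_Beta) auto
    also have "\<dots> \<le> ennreal \<kappa>\<^sub>1"
    proof -
      have "ln (t / a) powr \<alpha> \<le> L powr \<alpha>"
        unfolding L_def using t ab \<alpha> by (intro powr_mono2) (auto simp: divide_right_mono)
      then show ?thesis using \<alpha> by (auto simp: \<kappa>\<^sub>1_def intro!: ennreal_leI mult_right_mono less_imp_le[OF Beta_real_pos])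
    qed
    finally show ?thesis .
  qed
  have k2: "(\<integral>\<^sup>+t. ennreal (k t s) \<partial>lborel) \<le> ennreal \<kappa>\<^sub>2 * indicator {a<..<b} s" for s
  proof (cases "s \<in> {a<..<b}")
    case True
    have "(\<integral>\<^sup>+t. ennreal (k t s) \<partial>lborel) \<le> (\<integral>\<^sup>+t. ennreal (b / a) * ennreal (indicator {s<..<b} t *
        (ln (t / s) powr (\<alpha> - 1) * ln (b / t) powr (1 - 1) / t)) \<partial>lborel)"
    proof (intro nn_integral_mono)
      fix t :: real
      \<comment> \<open>Integration is now over \<open>t\<close>, where the Beta integral wants the
        weight \<open>1 / t\<close>; since \<open>t < b\<close> and \<open>a < s\<close>, the factor
        \<open>b / a\<close> pays for the exchange.\<close>
      have "ln (t / s) powr (\<alpha> - 1) / s \<le> b / a * (ln (t / s) powr (\<alpha> - 1) / t)" if t: "s < t" "t < b"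
      proof -
        have "1 / s \<le> b / a * (1 / t)"
          using True ab t mult_mono[of a s t b] by (simp add: field_simps)
        then have "ln (t / s) powr (\<alpha> - 1) * (1 / s) \<le> ln (t / s) powr (\<alpha> - 1) * (b / a * (1 / t))"
          by (rule mult_left_mono) simp
        then show ?thesis by (simp add: mult.commute)
      qed
      then show "ennreal (k t s) \<le> ennreal (b / a) * ennreal (indicator {s<..<b} t *
        (ln (t / s) powr (\<alpha> - 1) * ln (b / t) powr (1 - 1) / t))"
        using ab True by (auto simp: k_def indicator_def ennreal_mult'[symmetric] intro!: ennreal_leI)
    qed
    also have "\<dots> = ennreal (b / a) * (\<integral>\<^sup>+t. ennreal (indicator {s<..<b} t *
        (ln (t / s) powr (\<alpha> - 1) * ln (b / t) powr (1 - 1) / t)) \<partial>lborel)"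
      by (rule nn_integral_cmult) measurable
    also have "\<dots> = ennreal (b / a) * ennreal (ln (b / s) powr (\<alpha> + 1 - 1) * Beta \<alpha> 1)"
      using True \<alpha> ab by (subst nn_integral_ln_powr_Beta) auto
    also have "\<dots> \<le> ennreal (b / a) * ennreal (L powr \<alpha> * Beta \<alpha> 1)"
    proof -
      have "ln (b / s) powr \<alpha> \<le> L powr \<alpha>"
        unfolding L_def using True ab \<alpha> by (intro powr_mono2) (auto simp: divide_left_mono)
      then show ?thesis using \<alpha> by (auto intro!: ennreal_leI mult_left_mono mult_right_mono less_imp_le[OF Beta_real_pos])
    qed
    also have "\<dots> = ennreal \<kappa>\<^sub>2" unfolding \<kappa>\<^sub>2_def by (rule ennreal_mult'[symmetric]) (use ab in simp)
    finally show ?thesis using True by simp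
  next
    case False
    then have "k t s = 0" for t by (auto simp: k_def)
    then show ?thesis by simp
  qed
  have "(\<integral>\<^sup>+x. ennreal (indicator {a<..<b} x * norm (u x) powr p) \<partial>lborel)
    \<le> ennreal C * (\<integral>\<^sup>+x. ennreal (indicator {a<..<b} x * norm (hadamard_deriv a \<alpha> u x) powr p) \<partial>lborel)"
    if u: "u \<in> AC a b" "u a = 0" for u :: "real \<Rightarrow> 'a"
  proof -
    obtain g where g: "integrable lborel g"
      "\<And>t. t \<in> {a..b} \<Longrightarrow> u t - u a = (LINT x:{a..t}|lborel. g x)"
      "AE x in lebesgue. x \<in> {a<..<b} \<longrightarrow> (u has_vector_derivative g x) (at x)"
      using AC_fundamental_theorem[OF u(1) less_imp_le[OF ab(2)]] by metis
    have [measurable]: "g \<in> borel_measurable borel" using g by auto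
    define D where "D = (\<lambda>s. LINT \<tau>|lborel. (indicator {a<..<s} \<tau> * ln (s / \<tau>) powr (- \<alpha>)) *\<^sub>R g \<tau>)"
    \<comment> \<open>Written as a condition on the pair, the integrand is visibly measurable in
      both variables jointly, which makes \<open>D\<close> measurable.\<close>
    have "D = (\<lambda>s. LINT \<tau>|lborel. (if a < \<tau> \<and> \<tau> < s then ln (s / \<tau>) powr (- \<alpha>) else 0) *\<^sub>R g \<tau>)"
      unfolding D_def by (intro ext Bochner_Integration.integral_cong) (auto simp: indicator_def)
    then have [measurable]: "D \<in> borel_measurable borel" by simp
    have hD: "norm (D s) powr p = \<Gamma> powr p * norm (hadamard_deriv a \<alpha> u s) powr p" if "s \<in> {a<..<b}" for s
      using hadamard_deriv_eq[OF g(1) that ab(1) g(3), of \<alpha>] pos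
      by (simp add: D_def \<Gamma>_def powr_mult powr_divide)
    have pt: "ennreal (indicator {a<..<b} t * norm (u t) powr p) \<le> ennreal (\<kappa>\<^sub>1 powr (p - 1) / B powr p) *
        (\<integral>\<^sup>+s. ennreal (k t s * norm (D s) powr p) \<partial>lborel)" for t
    proof (cases "t \<in> {a<..<b}")
      case True
      have ut: "u t = (LINT x:{a..t}|lborel. g x)" using g(2)[of t] u(2) True by simp
      have "ennreal (B * norm (u t)) \<le> (\<integral>\<^sup>+s. ennreal (indicator {a<..<t} s * (ln (t / s) powr (\<alpha> - 1) / s) * norm (D s)) \<partial>lborel)"
        unfolding ut B_def using norm_integral_le_Abel[OF g(1) \<alpha> ab(1) _ D_def] True by simp
      also have "\<dots> = (\<integral>\<^sup>+s. ennreal (k t s * norm (D s)) \<partial>lborel)"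
        using True by (intro nn_integral_cong) (auto simp: k_def indicator_def)
      finally have "ennreal (B * norm (u t)) \<le> (\<integral>\<^sup>+s. ennreal (k t s * norm (D s)) \<partial>lborel)" .
      then have "ennreal ((B * norm (u t)) powr p) \<le> ennreal (\<kappa>\<^sub>1 powr (p - 1)) * (\<integral>\<^sup>+s. ennreal (k t s * norm (D s) powr p) \<partial>lborel)"
        using k0 k1[OF True] pos p by (intro powr_le_nn_integral_kernel) auto
      then have "ennreal (1 / B powr p) * ennreal ((B * norm (u t)) powr p) \<le> ennreal (1 / B powr p) *
          (ennreal (\<kappa>\<^sub>1 powr (p - 1)) * (\<integral>\<^sup>+s. ennreal (k t s * norm (D s) powr p) \<partial>lborel))"
        by (intro mult_left_mono) auto
      moreover have "ennreal (1 / B powr p) * ennreal ((B * norm (u t)) powr p) = ennreal (norm (u t) powr p)"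
        using pos by (simp add: ennreal_mult'[symmetric] powr_mult)
      moreover have "ennreal (1 / B powr p) * ennreal (\<kappa>\<^sub>1 powr (p - 1)) = ennreal (\<kappa>\<^sub>1 powr (p - 1) / B powr p)"
        by (simp add: ennreal_mult'[symmetric])
      ultimately show ?thesis using True by (simp add: mult.assoc[symmetric])
    qed simp
    \<comment> \<open>The second half of Schur's test: after exchanging the integrals, the kernel is
      integrated over \<open>t\<close> with \<open>D\<close> held fixed.\<close>
    have "(\<integral>\<^sup>+t. \<integral>\<^sup>+s. ennreal (k t s * norm (D s) powr p) \<partial>lborel \<partial>lborel)
        = (\<integral>\<^sup>+s. \<integral>\<^sup>+t. ennreal (k t s * norm (D s) powr p) \<partial>lborel \<partial>lborel)"
      by (rule lborel_pair.Fubini'[symmetric]) measurable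
    also have "\<dots> = (\<integral>\<^sup>+s. (\<integral>\<^sup>+t. ennreal (k t s) \<partial>lborel) * ennreal (norm (D s) powr p) \<partial>lborel)"
      using k0 by (intro nn_integral_cong) (simp add: ennreal_mult' nn_integral_multc)
    also have "\<dots> \<le> (\<integral>\<^sup>+s. ennreal (\<kappa>\<^sub>2 * \<Gamma> powr p) * ennreal (indicator {a<..<b} s * norm (hadamard_deriv a \<alpha> u s) powr p) \<partial>lborel)"
    proof (intro nn_integral_mono)
      fix s
      have "(\<integral>\<^sup>+t. ennreal (k t s) \<partial>lborel) * ennreal (norm (D s) powr p) \<le> ennreal \<kappa>\<^sub>2 * indicator {a<..<b} s * ennreal (norm (D s) powr p)"
        by (intro mult_right_mono k2) auto
      also have "\<dots> = ennreal (\<kappa>\<^sub>2 * \<Gamma> powr p) * ennreal (indicator {a<..<b} s * norm (hadamard_deriv a \<alpha> u s) powr p)"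
        using pos hD[of s] by (cases "s \<in> {a<..<b}") (auto simp: ennreal_mult' mult.assoc)
      finally show "(\<integral>\<^sup>+t. ennreal (k t s) \<partial>lborel) * ennreal (norm (D s) powr p) \<le> ennreal (\<kappa>\<^sub>2 * \<Gamma> powr p) * ennreal (indicator {a<..<b} s * norm (hadamard_deriv a \<alpha> u s) powr p)" .
    qed
    also have "\<dots> = ennreal (\<kappa>\<^sub>2 * \<Gamma> powr p) * (\<integral>\<^sup>+s. ennreal (indicator {a<..<b} s * norm (hadamard_deriv a \<alpha> u s) powr p) \<partial>lborel)"
    proof (rule nn_integral_cmult)
      \<comment> \<open>Measurability of the Hadamard derivative on the interval is inherited from
        \<open>D\<close>, of which it is a multiple there.\<close>
      have "(\<lambda>s. ennreal (indicator {a<..<b} s * (norm (D s) powr p / \<Gamma> powr p))) \<in> borel_measurable lborel" by measurable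
      also have "(\<lambda>s. ennreal (indicator {a<..<b} s * (norm (D s) powr p / \<Gamma> powr p)))
          = (\<lambda>s. ennreal (indicator {a<..<b} s * norm (hadamard_deriv a \<alpha> u s) powr p))"
        using hD pos by (auto simp: indicator_def fun_eq_iff)
      finally show "(\<lambda>s. ennreal (indicator {a<..<b} s * norm (hadamard_deriv a \<alpha> u s) powr p)) \<in> borel_measurable lborel" .
    qed
    finally have inner: "(\<integral>\<^sup>+t. \<integral>\<^sup>+s. ennreal (k t s * norm (D s) powr p) \<partial>lborel \<partial>lborel)
      \<le> ennreal (\<kappa>\<^sub>2 * \<Gamma> powr p) * (\<integral>\<^sup>+s. ennreal (indicator {a<..<b} s * norm (hadamard_deriv a \<alpha> u s) powr p) \<partial>lborel)" .
    have "(\<integral>\<^sup>+x. ennreal (indicator {a<..<b} x * norm (u x) powr p) \<partial>lborel)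
        \<le> (\<integral>\<^sup>+t. ennreal (\<kappa>\<^sub>1 powr (p - 1) / B powr p) * (\<integral>\<^sup>+s. ennreal (k t s * norm (D s) powr p) \<partial>lborel) \<partial>lborel)"
      by (intro nn_integral_mono pt)
    also have "\<dots> = ennreal (\<kappa>\<^sub>1 powr (p - 1) / B powr p) * (\<integral>\<^sup>+t. \<integral>\<^sup>+s. ennreal (k t s * norm (D s) powr p) \<partial>lborel \<partial>lborel)"
      by (rule nn_integral_cmult) measurable
    also have "\<dots> \<le> ennreal (\<kappa>\<^sub>1 powr (p - 1) / B powr p) * (ennreal (\<kappa>\<^sub>2 * \<Gamma> powr p) *
        (\<integral>\<^sup>+s. ennreal (indicator {a<..<b} s * norm (hadamard_deriv a \<alpha> u s) powr p) \<partial>lborel))"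
      by (intro mult_left_mono inner) simp
    also have "\<dots> = ennreal C * (\<integral>\<^sup>+s. ennreal (indicator {a<..<b} s * norm (hadamard_deriv a \<alpha> u s) powr p) \<partial>lborel)"
    proof -
      have "ennreal C = ennreal (\<kappa>\<^sub>1 powr (p - 1) / B powr p) * ennreal (\<kappa>\<^sub>2 * \<Gamma> powr p)"
        unfolding C_def by (rule ennreal_mult') simp
      then show ?thesis by (simp only: mult.assoc)
    qed
    finally show ?thesis .
  qed
  moreover have "C > 0" unfolding C_def using pos by simp
  ultimately show ?thesis by blast
qed

section \<open>Weighted estimates and interpolation\<close>

lemma AC_continuous_on:
  assumes u: "u \<in> AC a b" shows "continuous_on {a..b} u"
  unfolding continuous_on_iff
proof (intro ballI allI impI)
  fix x e :: real assume x: "x \<in> {a..b}" and e: "e > 0"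
  obtain \<eta> where \<eta>: "\<eta> > 0" "\<And>x y. a \<le> x \<Longrightarrow> x \<le> y \<Longrightarrow> y \<le> b \<Longrightarrow> y - x < \<eta> \<Longrightarrow> norm (u y - u x) < e"
    using AC_dist_less[OF u e] by blast
  have "dist (u y) (u x) < e" if y: "y \<in> {a..b}" "dist y x < \<eta>" for y
  proof (cases "x \<le> y")
    case True
    then show ?thesis using \<eta>(2)[of x y] x y by (simp add: dist_norm)
  next
    case False
    then show ?thesis using \<eta>(2)[of y x] x y by (simp add: dist_norm norm_minus_commute)
  qed
  then show "\<exists>d>0. \<forall>x'\<in>{a..b}. dist x' x < d \<longrightarrow> dist (u x') (u x) < e" using \<eta>(1) by blast
qed

text \<open>The power is monotone or antitone according to the sign of \<open>k\<close>, so its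
  extreme values lie at the endpoints.\<close>

lemma powr_bounds:
  fixes a b k :: real
  assumes "0 < a" "a \<le> x" "x \<le> b"
  shows "min (a powr k) (b powr k) \<le> x powr k" "x powr k \<le> max (a powr k) (b powr k)"
proof -
  have "a powr k \<le> x powr k \<and> x powr k \<le> b powr k \<or> b powr k \<le> x powr k \<and> x powr k \<le> a powr k"
    using assms powr_mono2[of k a x] powr_mono2[of k x b] powr_mono2'[of k a x] powr_mono2'[of k x b]
    by (cases "k \<ge> 0") auto
  then show "min (a powr k) (b powr k) \<le> x powr k" "x powr k \<le> max (a powr k) (b powr k)" by auto
qed

lemma nn_integral_dx_on:
  "(\<integral>\<^sup>+x. ennreal (f x) \<partial>dx_on a b) = (\<integral>\<^sup>+x. ennreal (indicator {a<..<b} x * f x) \<partial>lborel)"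
  unfolding dx_on_def
  by (subst nn_integral_restrict_space)
    (auto simp: nn_integral_completion indicator_def intro!: nn_integral_cong)

lemma nn_integral_dx_over_x_on:
  assumes f: "f \<in> borel_measurable (dx_over_x_on a b)" and a: "0 < a" and f0: "\<And>x. 0 \<le> f x"
  shows "(\<integral>\<^sup>+x. ennreal (f x) \<partial>dx_over_x_on a b) = (\<integral>\<^sup>+x. ennreal (indicator {a<..<b} x * (f x / x)) \<partial>lborel)"
proof -
  have "(\<lambda>x. ennreal (1 / x)) \<in> borel_measurable (lebesgue_on {a<..<b})"
    by (intro measurable_compose[OF _ measurable_ennreal] measurable_restrict_space1 measurable_completion) measurable
  moreover have "(\<lambda>x. ennreal (f x)) \<in> borel_measurable (lebesgue_on {a<..<b})"
    using f unfolding dx_over_x_on_def by (simp cong: measurable_cong_sets)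
  ultimately have "(\<integral>\<^sup>+x. ennreal (f x) \<partial>dx_over_x_on a b) = (\<integral>\<^sup>+x. ennreal (1 / x) * ennreal (f x) \<partial>dx_on a b)"
    unfolding dx_over_x_on_def dx_on_def by (rule nn_integral_density)
  also have "\<dots> = (\<integral>\<^sup>+x. ennreal (f x / x) \<partial>dx_on a b)"
    using f0 by (intro nn_integral_cong) (simp add: ennreal_mult''[symmetric])
  finally show ?thesis unfolding nn_integral_dx_on .
qed

text \<open>The endpoint \<open>\<delta> = 1\<close> of the theorem, where \<open>c\<close> is
  \<open>d - 1\<close> and \<open>r\<close> is \<open>p\<close>. The weights are absorbed into the
  constant on both sides of the unweighted estimate.\<close>

lemma weighted_Lp_norm_le_hadamard_deriv:
  fixes a b \<alpha> p d :: real
  assumes ab: "0 < a" "a < b" and \<alpha>: "0 < \<alpha>" "\<alpha> < 1" and p: "1 < p"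
  shows "\<exists>C>0. \<forall>u :: real \<Rightarrow> 'a::euclidean_space. u \<in> AC a b \<longrightarrow> u a = 0 \<longrightarrow>
    (\<lambda>x. (x powr d) *\<^sub>R hadamard_deriv a \<alpha> u x) \<in> Lp_space (dx_over_x_on a b) p \<longrightarrow>
    (\<lambda>x. (x powr (d - 1)) *\<^sub>R u x) \<in> Lp_space (dx_on a b) p \<and>
    Lp_norm (dx_on a b) p (\<lambda>x. (x powr (d - 1)) *\<^sub>R u x) \<le>
      C * Lp_norm (dx_over_x_on a b) p (\<lambda>x. (x powr d) *\<^sub>R hadamard_deriv a \<alpha> u x)"
proof -
  obtain C where C: "C > 0" "\<And>u :: real \<Rightarrow> 'a. u \<in> AC a b \<Longrightarrow> u a = 0 \<Longrightarrow>
    (\<integral>\<^sup>+x. ennreal (indicator {a<..<b} x * norm (u x) powr p) \<partial>lborel)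
    \<le> ennreal C * (\<integral>\<^sup>+x. ennreal (indicator {a<..<b} x * norm (hadamard_deriv a \<alpha> u x) powr p) \<partial>lborel)"
    using Lp_norm_le_hadamard_deriv[OF ab \<alpha> p] by blast
  \<comment> \<open>\<open>M\<close> bounds the weight in the norm of \<open>u\<close> from above,
    \<open>m\<close> the weight in the norm of the derivative from below; the \<open>- 1\<close> in
    the exponent is the density of \<open>dx / x\<close>.\<close>
  define M m where "M = max (a powr ((d - 1) * p)) (b powr ((d - 1) * p))"
    and "m = min (a powr (d * p - 1)) (b powr (d * p - 1))"
  have Mm: "M > 0" "m > 0" using ab by (auto simp: M_def m_def less_max_iff_disj)
  define C' where "C' = M * C / m"
  have C': "C' > 0" using Mm C by (simp add: C'_def)
  have "(\<lambda>x. (x powr (d - 1)) *\<^sub>R u x) \<in> Lp_space (dx_on a b) p \<and>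
    Lp_norm (dx_on a b) p (\<lambda>x. (x powr (d - 1)) *\<^sub>R u x) \<le>
      C' powr (1 / p) * Lp_norm (dx_over_x_on a b) p (\<lambda>x. (x powr d) *\<^sub>R hadamard_deriv a \<alpha> u x)"
    if u: "u \<in> AC a b" "u a = 0"
      and D: "(\<lambda>x. (x powr d) *\<^sub>R hadamard_deriv a \<alpha> u x) \<in> Lp_space (dx_over_x_on a b) p" for u :: "real \<Rightarrow> 'a"
  proof -
    let ?D = "hadamard_deriv a \<alpha> u"
    let ?v = "\<lambda>x. (x powr (d - 1)) *\<^sub>R u x" and ?w = "\<lambda>x. (x powr d) *\<^sub>R ?D x"
    have wm: "?w \<in> borel_measurable (dx_over_x_on a b)" and wi: "integrable (dx_over_x_on a b) (\<lambda>x. norm (?w x) powr p)"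
      using D by (auto simp: Lp_space_def)
    have "continuous_on {a<..<b} ?v"
      using ab by (intro continuous_intros continuous_on_subset[OF AC_continuous_on[OF u(1)]]) auto
    then have vm[measurable]: "?v \<in> borel_measurable (dx_on a b)"
      unfolding dx_on_def by (intro continuous_imp_measurable_on_sets_lebesgue) auto
    have bv: "norm (?v x) powr p \<le> M * norm (u x) powr p" if "x \<in> {a<..<b}" for x
    proof -
      have "norm (?v x) powr p = x powr ((d - 1) * p) * norm (u x) powr p"
        by (simp add: powr_mult powr_powr)
      also have "\<dots> \<le> M * norm (u x) powr p"
        unfolding M_def using that ab by (intro mult_right_mono powr_bounds) auto
      finally show ?thesis .
    qed
    have bw: "norm (?D x) powr p \<le> (1 / m) * (norm (?w x) powr p / x)" if "x \<in> {a<..<b}" for x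
    proof -
      have "m * norm (?D x) powr p \<le> x powr (d * p - 1) * norm (?D x) powr p"
        unfolding m_def using that ab by (intro mult_right_mono powr_bounds) auto
      also have "\<dots> = norm (?w x) powr p / x"
        using that ab by (simp add: powr_mult powr_powr powr_diff)
      finally have "norm (?D x) powr p \<le> (norm (?w x) powr p / x) / m"
        using Mm(2) by (simp only: pos_le_divide_eq mult.commute)
      then show ?thesis by (simp add: mult.commute)
    qed
    define W where "W = (LINT x|dx_over_x_on a b. norm (?w x) powr p)"
    have W: "W \<ge> 0" "(\<integral>\<^sup>+x. ennreal (norm (?w x) powr p) \<partial>dx_over_x_on a b) = ennreal W"
      unfolding W_def using wi by (auto intro: nn_integral_eq_integral)
    have "(\<integral>\<^sup>+x. ennreal (norm (?v x) powr p) \<partial>dx_on a b)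
        \<le> (\<integral>\<^sup>+x. ennreal (M * norm (u x) powr p) \<partial>dx_on a b)"
      using bv by (intro nn_integral_mono ennreal_leI) (auto simp: dx_on_def)
    also have "\<dots> = (\<integral>\<^sup>+x. ennreal M * ennreal (indicator {a<..<b} x * norm (u x) powr p) \<partial>lborel)"
      unfolding nn_integral_dx_on using Mm
      by (intro nn_integral_cong) (auto simp: indicator_def ennreal_mult')
    also have "\<dots> = ennreal M * (\<integral>\<^sup>+x. ennreal (indicator {a<..<b} x * norm (u x) powr p) \<partial>lborel)"
    proof (rule nn_integral_cmult)
      have "(\<lambda>x. indicator {a<..<b} x *\<^sub>R u x) \<in> borel_measurable borel"
        by (intro borel_measurable_continuous_on_indicator continuous_on_subset[OF AC_continuous_on[OF u(1)]]) auto
      then have "(\<lambda>x. ennreal (norm (indicator {a<..<b} x *\<^sub>R u x) powr p)) \<in> borel_measurable lborel" by measurable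
      also have "(\<lambda>x. ennreal (norm (indicator {a<..<b} x *\<^sub>R u x) powr p)) = (\<lambda>x. ennreal (indicator {a<..<b} x * norm (u x) powr p))"
        by (auto simp: indicator_def fun_eq_iff)
      finally show "(\<lambda>x. ennreal (indicator {a<..<b} x * norm (u x) powr p)) \<in> borel_measurable lborel" .
    qed
    also have "\<dots> \<le> ennreal M * (ennreal C * (\<integral>\<^sup>+x. ennreal (indicator {a<..<b} x * norm (?D x) powr p) \<partial>lborel))"
      by (intro mult_left_mono C(2) u) auto
    also have "\<dots> \<le> ennreal M * (ennreal C * (ennreal (1 / m) * (\<integral>\<^sup>+x. ennreal (norm (?w x) powr p) \<partial>dx_over_x_on a b)))"
    proof (intro mult_left_mono)
      have meas: "(\<lambda>x. norm (?w x) powr p) \<in> borel_measurable (dx_over_x_on a b)"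
        using wm by measurable
      have "(\<integral>\<^sup>+x. ennreal (indicator {a<..<b} x * norm (?D x) powr p) \<partial>lborel) =
          (\<integral>\<^sup>+x. ennreal (norm (?D x) powr p) \<partial>dx_on a b)" by (rule nn_integral_dx_on[symmetric])
      also have "\<dots> \<le> (\<integral>\<^sup>+x. ennreal (1 / m) * ennreal (norm (?w x) powr p / x) \<partial>dx_on a b)"
        using bw Mm ab by (intro nn_integral_mono) (auto simp: dx_on_def ennreal_mult''[symmetric] intro!: ennreal_leI)
      also have "\<dots> = ennreal (1 / m) * (\<integral>\<^sup>+x. ennreal (norm (?w x) powr p / x) \<partial>dx_on a b)"
      proof (rule nn_integral_cmult)
        have "(\<lambda>x. norm (?w x) powr p) \<in> borel_measurable (dx_on a b)"
          using meas unfolding dx_over_x_on_def dx_on_def by (simp cong: measurable_cong_sets)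
        moreover have "(\<lambda>x::real. x) \<in> borel_measurable (dx_on a b)"
          unfolding dx_on_def by (intro measurable_restrict_space1 measurable_completion) measurable
        ultimately show "(\<lambda>x. ennreal (norm (?w x) powr p / x)) \<in> borel_measurable (dx_on a b)"
          by (intro measurable_compose[OF _ measurable_ennreal] borel_measurable_divide)
      qed
      also have "(\<integral>\<^sup>+x. ennreal (norm (?w x) powr p / x) \<partial>dx_on a b) = (\<integral>\<^sup>+x. ennreal (norm (?w x) powr p) \<partial>dx_over_x_on a b)"
        unfolding nn_integral_dx_over_x_on[OF meas ab(1) powr_ge_zero] nn_integral_dx_on ..
      finally show "(\<integral>\<^sup>+x. ennreal (indicator {a<..<b} x * norm (?D x) powr p) \<partial>lborel)
        \<le> ennreal (1 / m) * (\<integral>\<^sup>+x. ennreal (norm (?w x) powr p) \<partial>dx_over_x_on a b)" .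
    qed auto
    also have "\<dots> = ennreal (M * (C * (1 / m * W)))"
      unfolding W(2) using Mm C(1) W(1) by (simp add: ennreal_mult'[symmetric])
    also have "M * (C * (1 / m * W)) = C' * W" by (simp add: C'_def)
    finally have le: "(\<integral>\<^sup>+x. ennreal (norm (?v x) powr p) \<partial>dx_on a b) \<le> ennreal (C' * W)" .
    have vi: "integrable (dx_on a b) (\<lambda>x. norm (?v x) powr p)"
    proof (rule integrableI_nonneg)
      show "(\<lambda>x. norm (?v x) powr p) \<in> borel_measurable (dx_on a b)"
        by (rule measurable_compose[OF vm, where g = "\<lambda>y. norm y powr p"]) measurable
      show "(\<integral>\<^sup>+x. ennreal (norm (?v x) powr p) \<partial>dx_on a b) < \<infinity>" by (rule le_less_trans[OF le]) simp
    qed simp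
    have "ennreal (LINT x|dx_on a b. norm (?v x) powr p) \<le> ennreal (C' * W)"
      using le nn_integral_eq_integral[OF vi] by simp
    then have "(LINT x|dx_on a b. norm (?v x) powr p) \<le> C' * W"
      using C' W(1) by (subst (asm) ennreal_le_iff) auto
    then have "Lp_norm (dx_on a b) p ?v \<le> (C' * W) powr (1 / p)"
      unfolding Lp_norm_def using p by (intro powr_mono2) auto
    also have "\<dots> = C' powr (1 / p) * Lp_norm (dx_over_x_on a b) p ?w"
      using C' W(1) by (simp add: Lp_norm_def W_def powr_mult)
    finally show ?thesis using vm vi by (simp add: Lp_space_def)
  qed
  moreover have "C' powr (1 / p) > 0" using C' by simp
  ultimately show ?thesis by blast
qed

text \<open>With \<open>\<theta> = \<delta> * r / p\<close> the relation between the exponents says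
  precisely that \<open>1 - \<theta> = (1 - \<delta>) * r / q\<close>, so
  \<open>p / (\<delta> * r)\<close> and \<open>q / ((1 - \<delta>) * r)\<close> are conjugate. The
  r-th root is taken only at the end, so \<open>r < 1\<close> causes no difficulty.\<close>

lemma Lp_interpolation:
  fixes v w :: "'a \<Rightarrow> 'b::real_normed_vector"
  assumes v: "v \<in> Lp_space M p" and w: "w \<in> Lp_space M q"
    and pos: "0 < p" "0 < q" "0 < r" and \<delta>: "0 < \<delta>" "\<delta> < 1" "\<delta> / p + (1 - \<delta>) / q = 1 / r"
  shows "integrable M (\<lambda>x. (norm (v x) powr \<delta> * norm (w x) powr (1 - \<delta>)) powr r)"
    and "(LINT x|M. (norm (v x) powr \<delta> * norm (w x) powr (1 - \<delta>)) powr r) powr (1 / r)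
      \<le> Lp_norm M p v powr \<delta> * Lp_norm M q w powr (1 - \<delta>)"
proof -
  define \<theta> where "\<theta> = \<delta> * r / p"
  have \<theta>1: "1 - \<theta> = (1 - \<delta>) * r / q"
    using \<delta>(3) pos by (simp add: \<theta>_def field_simps)
  have \<theta>: "0 < \<theta>" "0 < 1 - \<theta>" unfolding \<theta>1 using pos \<delta> by (simp_all add: \<theta>_def)
  have \<theta>r: "p * \<theta> = \<delta> * r" "q * (1 - \<theta>) = (1 - \<delta>) * r" unfolding \<theta>1 using pos by (simp_all add: \<theta>_def)
  have \<theta>s: "\<theta> / r = \<delta> / p" "(1 - \<theta>) / r = (1 - \<delta>) / q" unfolding \<theta>1 using pos by (simp_all add: \<theta>_def)
  have eq: "(norm (v x) powr p) powr \<theta> * (norm (w x) powr q) powr (1 - \<theta>) = (norm (v x) powr \<delta> * norm (w x) powr (1 - \<delta>)) powr r" for x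
    by (simp add: powr_powr powr_mult \<theta>r)
  note H = Holder_powr[of M "\<lambda>x. norm (v x) powr p" "\<lambda>x. norm (w x) powr q" \<theta>, unfolded eq]
  show "integrable M (\<lambda>x. (norm (v x) powr \<delta> * norm (w x) powr (1 - \<delta>)) powr r)"
    using v w \<theta> by (intro H(1)) (auto simp: Lp_space_def)
  have "(LINT x|M. (norm (v x) powr \<delta> * norm (w x) powr (1 - \<delta>)) powr r)
      \<le> (LINT x|M. norm (v x) powr p) powr \<theta> * (LINT x|M. norm (w x) powr q) powr (1 - \<theta>)"
    using v w \<theta> by (intro H(2)) (auto simp: Lp_space_def)
  then have "(LINT x|M. (norm (v x) powr \<delta> * norm (w x) powr (1 - \<delta>)) powr r) powr (1 / r)
      \<le> ((LINT x|M. norm (v x) powr p) powr \<theta> * (LINT x|M. norm (w x) powr q) powr (1 - \<theta>)) powr (1 / r)"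
    using pos by (intro powr_mono2) auto
  also have "\<dots> = Lp_norm M p v powr \<delta> * Lp_norm M q w powr (1 - \<delta>)"
    unfolding Lp_norm_def by (simp add: powr_powr powr_mult \<theta>s)
  finally show "(LINT x|M. (norm (v x) powr \<delta> * norm (w x) powr (1 - \<delta>)) powr r) powr (1 / r)
      \<le> Lp_norm M p v powr \<delta> * Lp_norm M q w powr (1 - \<delta>)" .
qed

theorem theorem5p9:
  fixes a b p q \<alpha> r \<delta> c d e :: real
  assumes "0 < a" and "a < b"
    and "1 < p" and "1 < q"
    and "\<alpha> \<in> {1 - 1 / q<..<1}"
    and "0 < r" and "p + q \<ge> r"
    and "\<delta> \<in> {0..1} \<inter> {(r - q) / r..p / r}"
    and "\<delta> / p + (1 - \<delta>) / q = 1 / r"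
    and "c = \<delta> * (d - 1) + e * (1 - \<delta>)"
    and "1 + (d - 1) * p > 0"
  shows "\<exists>C>0. \<forall>u :: real \<Rightarrow> 'a::{real_normed_field, euclidean_space}.
    u \<in> AC a b \<longrightarrow> u a = 0 \<longrightarrow>
    (\<lambda>x. (x powr d) *\<^sub>R hadamard_deriv a \<alpha> u x) \<in> Lp_space (dx_over_x_on a b) p \<longrightarrow>
    (\<lambda>x. (x powr e) *\<^sub>R u x) \<in> Lp_space (dx_on a b) q \<longrightarrow>
    (\<lambda>x. (x powr c) *\<^sub>R u x) \<in> Lp_space (dx_on a b) r \<and>
    Lp_norm (dx_on a b) r (\<lambda>x. (x powr c) *\<^sub>R u x) \<le>
      C * rpow (Lp_norm (dx_over_x_on a b) p (\<lambda>x. (x powr d) *\<^sub>R hadamard_deriv a \<alpha> u x)) \<delta>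
        * rpow (Lp_norm (dx_on a b) q (\<lambda>x. (x powr e) *\<^sub>R u x)) (1 - \<delta>)"
proof -
  have "1 / q < 1" using \<open>1 < q\<close> by simp
  then have \<alpha>: "0 < \<alpha>" "\<alpha> < 1" using assms(5) by auto
  have Lp0: "0 \<le> Lp_norm M s v" for M s and v :: "real \<Rightarrow> 'a" by (simp add: Lp_norm_def)
  obtain C where C: "C > 0" "\<And>u :: real \<Rightarrow> 'a. u \<in> AC a b \<Longrightarrow> u a = 0 \<Longrightarrow>
    (\<lambda>x. (x powr d) *\<^sub>R hadamard_deriv a \<alpha> u x) \<in> Lp_space (dx_over_x_on a b) p \<Longrightarrow>
    (\<lambda>x. (x powr (d - 1)) *\<^sub>R u x) \<in> Lp_space (dx_on a b) p \<and>
    Lp_norm (dx_on a b) p (\<lambda>x. (x powr (d - 1)) *\<^sub>R u x) \<le>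
      C * Lp_norm (dx_over_x_on a b) p (\<lambda>x. (x powr d) *\<^sub>R hadamard_deriv a \<alpha> u x)"
    using weighted_Lp_norm_le_hadamard_deriv[OF assms(1,2) \<alpha> assms(3), of d] by blast
  consider "\<delta> = 0" | "\<delta> = 1" | "0 < \<delta>" "\<delta> < 1" using assms(8) by fastforce
  then show ?thesis
  proof cases
    case 1
    \<comment> \<open>The claim is an equality with constant 1: \<open>rpow\<close> makes the first
      factor 1 even if the norm of the derivative is 0.\<close>
    then have "r = q" "c = e" using assms by auto
    then show ?thesis using 1 Lp0 by (intro exI[of _ 1]) (auto simp: rpow_def)
  next
    case 2
    then have "r = p" "c = d - 1" using assms by auto
    then show ?thesis using 2 C Lp0 by (intro exI[of _ C]) (auto simp: rpow_def)
  next
    case 3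
    show ?thesis
    proof (intro exI[of _ "C powr \<delta>"] conjI allI impI)
      show "C powr \<delta> > 0" using C(1) by simp
      fix u :: "real \<Rightarrow> 'a"
      let ?w = "\<lambda>x. (x powr d) *\<^sub>R hadamard_deriv a \<alpha> u x"
        and ?v = "\<lambda>x. (x powr (d - 1)) *\<^sub>R u x" and ?z = "\<lambda>x. (x powr e) *\<^sub>R u x"
      assume u: "u \<in> AC a b" "u a = 0" and w: "?w \<in> Lp_space (dx_over_x_on a b) p"
        and z: "?z \<in> Lp_space (dx_on a b) q"
      have v: "?v \<in> Lp_space (dx_on a b) p" and vw: "Lp_norm (dx_on a b) p ?v \<le> C * Lp_norm (dx_over_x_on a b) p ?w"
        using C(2)[OF u w] by auto
      \<comment> \<open>The definition of \<open>c\<close> is what makes the two weights multiply to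
        \<open>x powr c\<close>; the powers of \<open>norm (u x)\<close> add up to the
        first.\<close>
      have eq: "norm (?v x) powr \<delta> * norm (?z x) powr (1 - \<delta>) = norm ((x powr c) *\<^sub>R u x)" for x
      proof -
        have "norm (?v x) powr \<delta> * norm (?z x) powr (1 - \<delta>)
            = (x powr ((d - 1) * \<delta>) * x powr (e * (1 - \<delta>))) * (norm (u x) powr \<delta> * norm (u x) powr (1 - \<delta>))"
          by (simp add: powr_mult powr_powr)
        also have "\<dots> = x powr c * norm (u x)"
          by (simp add: powr_add[symmetric] assms(10) mult.commute)
        finally show ?thesis by simp
      qed
      have pos: "0 < p" "0 < q" using assms by auto
      note I = Lp_interpolation[OF v z pos assms(6) 3 assms(9), unfolded eq]
      have "continuous_on {a<..<b} (\<lambda>x. (x powr c) *\<^sub>R u x)"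
        using assms(1) by (intro continuous_intros continuous_on_subset[OF AC_continuous_on[OF u(1)]]) auto
      then have "(\<lambda>x. (x powr c) *\<^sub>R u x) \<in> borel_measurable (dx_on a b)"
        unfolding dx_on_def by (intro continuous_imp_measurable_on_sets_lebesgue) auto
      with I(1) show "(\<lambda>x. (x powr c) *\<^sub>R u x) \<in> Lp_space (dx_on a b) r"
        by (simp add: Lp_space_def)
      have "Lp_norm (dx_on a b) r (\<lambda>x. (x powr c) *\<^sub>R u x)
          \<le> Lp_norm (dx_on a b) p ?v powr \<delta> * Lp_norm (dx_on a b) q ?z powr (1 - \<delta>)"
        using I(2) by (simp add: Lp_norm_def[of _ r])
      also have "\<dots> \<le> (C * Lp_norm (dx_over_x_on a b) p ?w) powr \<delta> * Lp_norm (dx_on a b) q ?z powr (1 - \<delta>)"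
        using vw 3 Lp0 by (intro mult_right_mono powr_mono2) auto
      also have "\<dots> = C powr \<delta> * rpow (Lp_norm (dx_over_x_on a b) p ?w) \<delta> * rpow (Lp_norm (dx_on a b) q ?z) (1 - \<delta>)"
        using C(1) Lp0 3 by (simp add: rpow_def powr_mult)
      finally show "Lp_norm (dx_on a b) r (\<lambda>x. (x powr c) *\<^sub>R u x)
          \<le> C powr \<delta> * rpow (Lp_norm (dx_over_x_on a b) p ?w) \<delta> * rpow (Lp_norm (dx_on a b) q ?z) (1 - \<delta>)" .
    qed
  qed
qed

end
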